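(* Let $Y$ be a real Banach space of dimension at least two, let $\mu$ be any measure with $\dim L_\infty(\mu)\ge2$, and let $K$ be any compact Hausdorff space which is not connected. The following are equivalent (all spaces being real): (i) the pair $(\ell_\infty^m,Y)$ has the BPBp-RSE for some $m\in\mathbb N$, $m\ge2$; (ii) the pair $(c_0,Y)$ has the BPBp-RSE; (iii) the pair $(\ell_\infty,Y)$ has the BPBp-RSE; (iv) the pair $(L_\infty(\mu),Y)$ has the BPBp-RSE; (v) the pair $(C(K),Y)$ has the BPBp-RSE; (vi) $Y$ is uniformly convex.
   Context: All Banach spaces here are real; $B_X$, $S_X$ are the closed unit ball and unit sphere of $X$; $\mathbb T=\{1,-1\}$; $\mathcal L(X,Y)$ is the space of bounded linear operators; $C(K)$ is the space of real continuous functions on $K$ with the supremum norm. An operator $T\in\mathcal L(X,Y)$ is range strongly exposing, $T\in\mathrm{RSE}(X,Y)$, if there is $x_0\in S_X$ such that whenever $(x_n)\subseteq B_X$ satisfies $\|Tx_n\|\to\|T\|$, there are a subsequence $(x_{\sigma(n)})$ and $\lambda\in\mathbb T$ with $Tx_{\sigma(n)}\to\lambda Tx_0$. The pair $(X,Y)$ has the BPBp-RSE if for every $\varepsilon>0$ there is $0<\eta(\varepsilon)<\varepsilon$ such that for every $T\in\mathcal L(X,Y)$ with $\|T\|=1$ and every $x\in S_X$ with $\|Tx\|>1-\eta(\varepsilon)$, there exist $S\in\mathrm{RSE}(X,Y)$ and $x_0\in S_X$ with $\|S\|=\|Sx_0\|=1$, $\|S-T\|<\varepsilon$ and $\|x-x_0\|<\varepsilon$.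 $Y$ is uniformly convex if for every $\varepsilon>0$ there is $0<\delta<1$ such that $y_1,y_2\in S_Y$ and $\|y_1+y_2\|/2>1-\delta$ imply $\|y_1-y_2\|<\varepsilon$. *)

theory Defs
  imports "HOL-Analysis.Analysis" "HOL-Probability.Essential_Supremum"
begin

text \<open>
  The domain spaces depend on terms (a natural number, a measure, a topology), so they cannot be
  instances of the type class of real normed spaces. They are given by an explicit carrier
  together with their vector space operations and norm. The range space is a type of class
  \<open>banach\<close>.
\<close>

record 'v nspace =
  carr :: "'v set"
  vadd :: "'v \<Rightarrow> 'v \<Rightarrow> 'v"
  vscale :: "real \<Rightarrow> 'v \<Rightarrow> 'v"
  vzero :: "'v"
  vnorm :: "'v \<Rightarrow> real"

definition vdiff :: "'v nspace \<Rightarrow> 'v \<Rightarrow> 'v \<Rightarrow> 'v" where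
  "vdiff X u v = vadd X u (vscale X (-1) v)"

definition unit_ball :: "'v nspace \<Rightarrow> 'v set" where
  "unit_ball X = {u \<in> carr X. vnorm X u \<le> 1}"

definition unit_sphere :: "'v nspace \<Rightarrow> 'v set" where
  "unit_sphere X = {u \<in> carr X. vnorm X u = 1}"

definition dim_ge_2 :: "'v nspace \<Rightarrow> bool" where
  "dim_ge_2 X \<longleftrightarrow> (\<exists>u\<in>carr X. \<exists>v\<in>carr X. \<forall>a b.
     vadd X (vscale X a u) (vscale X b v) = vzero X \<longrightarrow> a = 0 \<and> b = 0)"

text \<open>
  Operators are represented by total functions whose values off the carrier are irrelevant:
  every notion below depends only on the restriction to the carrier.
\<close>

definition bounded_ops :: "'v nspace \<Rightarrow> ('v \<Rightarrow> 'y::real_normed_vector) set" where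
  "bounded_ops X = {T.
     (\<forall>u\<in>carr X. \<forall>v\<in>carr X. T (vadd X u v) = T u + T v) \<and>
     (\<forall>c. \<forall>u\<in>carr X. T (vscale X c u) = c *\<^sub>R T u) \<and>
     (\<exists>C. \<forall>u\<in>carr X. norm (T u) \<le> C * vnorm X u)}"

definition op_norm :: "'v nspace \<Rightarrow> ('v \<Rightarrow> 'y::real_normed_vector) \<Rightarrow> real" where
  "op_norm X T = (SUP u\<in>unit_ball X. norm (T u))"

definition RSE :: "'v nspace \<Rightarrow> ('v \<Rightarrow> 'y::real_normed_vector) set" where
  "RSE X = {T \<in> bounded_ops X. \<exists>x0\<in>unit_sphere X.
     \<forall>x :: nat \<Rightarrow> 'v.
       (\<forall>n. x n \<in> unit_ball X) \<and> (\<lambda>n. norm (T (x n))) \<longlonglongrightarrow> op_norm X T \<longrightarrow>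
       (\<exists>s :: nat \<Rightarrow> nat. strict_mono s \<and>
          (\<exists>l\<in>{1, -1 :: real}. (\<lambda>n. T (x (s n))) \<longlonglongrightarrow> l *\<^sub>R T x0))}"

definition BPBp_RSE :: "'v nspace \<Rightarrow> 'y::real_normed_vector itself \<Rightarrow> bool" where
  "BPBp_RSE X Y \<longleftrightarrow> (\<forall>\<epsilon>>0. \<exists>\<eta>>0. \<eta> < \<epsilon> \<and>
     (\<forall>T :: 'v \<Rightarrow> 'y. T \<in> bounded_ops X \<longrightarrow> op_norm X T = 1 \<longrightarrow>
       (\<forall>x\<in>unit_sphere X. norm (T x) > 1 - \<eta> \<longrightarrow>
         (\<exists>S\<in>RSE X. \<exists>x0\<in>unit_sphere X.
            op_norm X S = 1 \<and> norm (S x0) = 1 \<and>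
            op_norm X (\<lambda>u. S u - T u) < \<epsilon> \<and> vnorm X (vdiff X x x0) < \<epsilon>))))"

definition uniformly_convex :: "'y::real_normed_vector itself \<Rightarrow> bool" where
  "uniformly_convex Y \<longleftrightarrow> (\<forall>\<epsilon>>0. \<exists>\<delta>>0. \<delta> < (1::real) \<and>
     (\<forall>y1 y2 :: 'y. norm y1 = 1 \<longrightarrow> norm y2 = 1 \<longrightarrow> norm (y1 + y2) / 2 > 1 - \<delta> \<longrightarrow>
        norm (y1 - y2) < \<epsilon>))"

text \<open>
  Sup-norm space of the bounded functions on the index set \<open>I\<close> that satisfy \<open>P\<close>. Functions are
  required to vanish off \<open>I\<close>, so that each function on \<open>I\<close> has a unique representative.
\<close>

definition sup_space :: "'i set \<Rightarrow> (('i \<Rightarrow> real) \<Rightarrow> bool) \<Rightarrow> ('i \<Rightarrow> real) nspace" where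
  "sup_space I P =
     \<lparr> carr = {f. P f \<and> bounded (f ` I) \<and> (\<forall>i. i \<notin> I \<longrightarrow> f i = 0)},
       vadd = (\<lambda>f g i. f i + g i),
       vscale = (\<lambda>c f i. c * f i),
       vzero = (\<lambda>i. 0),
       vnorm = (\<lambda>f. SUP i\<in>I. \<bar>f i\<bar>) \<rparr>"

definition linf_fin :: "nat \<Rightarrow> (nat \<Rightarrow> real) nspace" where
  "linf_fin m = sup_space {..<m} (\<lambda>f. True)"

definition c0_space :: "(nat \<Rightarrow> real) nspace" where
  "c0_space = sup_space UNIV (\<lambda>f. f \<longlonglongrightarrow> 0)"

definition linf_space :: "(nat \<Rightarrow> real) nspace" where
  "linf_space = sup_space UNIV (\<lambda>f. True)"

definition C_space :: "'k topology \<Rightarrow> ('k \<Rightarrow> real) nspace" where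
  "C_space K = sup_space (topspace K) (\<lambda>f. continuous_map K euclideanreal f)"

text \<open>
  The elements of \<open>Linf_space \<mu>\<close> are the classes, modulo equality almost everywhere, of the
  essentially bounded measurable real functions.
\<close>

definition ess_bdd :: "'a measure \<Rightarrow> ('a \<Rightarrow> real) set" where
  "ess_bdd \<mu> = {f \<in> borel_measurable \<mu>. esssup \<mu> (\<lambda>x. ereal \<bar>f x\<bar>) < \<infinity>}"

definition ae_eq :: "'a measure \<Rightarrow> (('a \<Rightarrow> real) \<times> ('a \<Rightarrow> real)) set" where
  "ae_eq \<mu> = {(f, g). f \<in> ess_bdd \<mu> \<and> g \<in> ess_bdd \<mu> \<and> (AE x in \<mu>. f x = g x)}"

definition Linf_space :: "'a measure \<Rightarrow> ('a \<Rightarrow> real) set nspace" where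
  "Linf_space \<mu> =
     \<lparr> carr = ess_bdd \<mu> // ae_eq \<mu>,
       vadd = (\<lambda>F G. \<Union>f\<in>F. \<Union>g\<in>G. ae_eq \<mu> `` {\<lambda>x. f x + g x}),
       vscale = (\<lambda>c F. \<Union>f\<in>F. ae_eq \<mu> `` {\<lambda>x. c * f x}),
       vzero = ae_eq \<mu> `` {\<lambda>x. 0},
       vnorm = (\<lambda>F. the_elem ((\<lambda>f. real_of_ereal (esssup \<mu> (\<lambda>x. ereal \<bar>f x\<bar>))) ` F)) \<rparr>"

end

theory Submission
  imports Defs
begin

text \<open>
  All the domain spaces are algebras of real functions modulo a filter. The index set is fixed, two
  functions are identified if they agree eventually along the filter, and the norm is the eventual
  bound. The filter is principal for the sequence spaces and for \<open>C(K)\<close>, and the almost everywhere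
  filter for \<open>L\<^sub>\<infinity>(\<mu>)\<close>. Both implications are proved once, for such algebras, with limits along
  ultrafilters in the role of point evaluations.

  If \<open>Y\<close> is uniformly convex, a contraction that nearly attains its norm at \<open>m\<close> is small on all
  functions bounded by \<open>1 - \<bar>m\<bar>\<close> (\<open>small_off_norming\<close>). Let \<open>T\<close> nearly attain its norm at \<open>x\<close>. Splitting
  \<open>x\<close> into a truncation and a soft threshold \<open>z\<close> gives a function \<open>x0\<close> near \<open>x\<close> which is unimodular where
  \<open>z\<close> does not vanish, while \<open>T\<close> still nearly attains its norm at \<open>z\<close>. This reduces the problem to moving
  a contraction \<open>V\<close> that nearly attains its norm at a unit \<open>e\<close> of the algebra to one that attains it
  exactly there. A single step tilts \<open>V\<close> by a small rank one operator, picks a point \<open>g\<close> at which the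
  tilted operator \<open>S\<close> almost attains its norm, and transports \<open>g\<close> back to \<open>e\<close> by replacing \<open>S\<close> with
  \<open>f \<mapsto> S (g f)\<close>. The tilt forces \<open>V g\<close> to be close to \<open>V e\<close>, which by the smallness principle makes
  multiplication by \<open>g\<close> harmless (\<open>improve_attainment\<close>). The steps are summable and their limit
  attains its norm at \<open>e\<close>; one more tilt makes it range strongly exposing. Since only multiplications
  by elements of the algebra occur, no representing measures and no biduals are involved.

  Conversely, an RSE operator of norm 1 takes, up to sign, only one value at the points of the ball
  where it attains its norm, so it vanishes at every function that can be added to and subtracted
  from such a point without leaving the ball. Given unit vectors \<open>y1\<close> and \<open>y2\<close> with a long midpoint, the
  operator with values \<open>(y1 + y2) / 2\<close> and \<open>(y1 - y2) / 2\<close> at two disjointly supported indicators nearly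
  attains its norm at the first indicator. Its RSE approximation kills the second one, so
  \<open>y1 - y2\<close> is short.
\<close>

section \<open>Uniform convexity on the unit ball\<close>

text \<open>
  Quantitative form of uniform convexity with the two radii made explicit; vectors range over the
  whole unit ball, so that it applies to the images of arbitrary points of a domain ball.
\<close>

definition convexity_gap :: "'y::real_normed_vector itself \<Rightarrow> real \<Rightarrow> real \<Rightarrow> bool" where
  "convexity_gap Y \<epsilon> \<delta> \<longleftrightarrow> 0 < \<delta> \<and>
     (\<forall>u v :: 'y. norm u \<le> 1 \<longrightarrow> norm v \<le> 1 \<longrightarrow> norm (u + v) > 2 - \<delta> \<longrightarrow> norm (u - v) < \<epsilon>)"

lemma convexity_gapD:
  fixes u v :: "'y::real_normed_vector"
  assumes "convexity_gap TYPE('y) \<epsilon> \<delta>" "norm u \<le> 1" "norm v \<le> 1" "norm (u + v) > 2 - \<delta>"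
  shows "norm (u - v) < \<epsilon>"
  using assms by (auto simp: convexity_gap_def)

lemma uniformly_convex_gap:
  assumes uc: "uniformly_convex TYPE('y::real_normed_vector)" and "\<epsilon> > 0"
  shows "\<exists>\<delta>. convexity_gap TYPE('y) \<epsilon> \<delta>"
proof -
  have "\<epsilon> / 2 > 0"
    using \<open>\<epsilon> > 0\<close> by simp
  from uc[unfolded uniformly_convex_def, rule_format, OF this]
  obtain d where d: "d > 0"
    "\<And>y1 y2 :: 'y. norm y1 = 1 \<Longrightarrow> norm y2 = 1 \<Longrightarrow> norm (y1 + y2) / 2 > 1 - d \<Longrightarrow> norm (y1 - y2) < \<epsilon> / 2"
    by blast
  define \<delta> where "\<delta> = min (1/2) (min (d / 2) (\<epsilon> / 4))"
  have \<delta>: "\<delta> > 0" "\<delta> \<le> 1/2" "\<delta> \<le> d / 2" "\<delta> \<le> \<epsilon> / 4"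
    using d(1) \<open>\<epsilon> > 0\<close> by (auto simp: \<delta>_def)
  have "norm (u - v) < \<epsilon>" if u: "norm u \<le> 1" and v: "norm v \<le> 1" and uv: "norm (u + v) > 2 - \<delta>"
    for u v :: 'y
  proof -
    have "norm (u + v) \<le> norm u + norm v"
      by (rule norm_triangle_ineq)
    then have nu: "norm u > 1 - \<delta>" and nv: "norm v > 1 - \<delta>"
      using u v uv by linarith+
    have near: "norm (w - w /\<^sub>R norm w) < \<delta>" "norm (w /\<^sub>R norm w) = 1"
      if w: "norm w \<le> 1" "norm w > 1 - \<delta>" for w :: 'y
    proof -
      have w0: "norm w > 0"
        using w \<delta> by linarith
      have "w - w /\<^sub>R norm w = (1 - 1 / norm w) *\<^sub>R w"
        by (simp add: algebra_simps divide_inverse)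
      then have "norm (w - w /\<^sub>R norm w) = \<bar>1 - 1 / norm w\<bar> * norm w"
        by simp
      also have "\<dots> = \<bar>norm w - 1\<bar>"
        using w0 by (simp add: abs_mult[symmetric] field_simps flip: abs_mult_pos)
      finally show "norm (w - w /\<^sub>R norm w) < \<delta>"
        using w by simp
      show "norm (w /\<^sub>R norm w) = 1"
        using w0 by simp
    qed
    let ?u = "u /\<^sub>R norm u" and ?v = "v /\<^sub>R norm v"
    note nnu = near[OF u nu] and nnv = near[OF v nv]
    have "u + v = (?u + ?v) + ((u - ?u) + (v - ?v))"
      by simp
    then have "norm (u + v) \<le> norm (?u + ?v) + (norm (u - ?u) + norm (v - ?v))"
      by (metis norm_triangle_ineq norm_triangle_le add_left_mono order_trans)
    then have "norm (?u + ?v) / 2 > 1 - d"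
      using nnu nnv uv \<delta> by simp
    then have "norm (?u - ?v) < \<epsilon> / 2"
      using d(2) nnu nnv by blast
    moreover have "u - v = (?u - ?v) + ((u - ?u) - (v - ?v))"
      by simp
    then have "norm (u - v) \<le> norm (?u - ?v) + (norm (u - ?u) + norm (v - ?v))"
      by (metis norm_triangle_ineq norm_triangle_ineq4 add_left_mono order_trans)
    ultimately show ?thesis
      using nnu nnv \<delta> by linarith
  qed
  then show ?thesis
    using \<delta>(1) unfolding convexity_gap_def by blast
qed

text \<open>
  This replaces a norming functional of the range space. In the convex combination
  \<open>u + \<delta>s v = \<delta>s (u + v) + (1 - \<delta>s) u\<close> the second term has norm at most \<open>1 - \<delta>s\<close>, so a left side that
  is nearly as long as possible forces \<open>u + v\<close> to be nearly of norm 2. In a uniformly convex space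
  \<open>u\<close> is then close to \<open>v\<close>.
\<close>

lemma norm_sum_ge_of_tilted:
  fixes u v :: "'y::real_normed_vector"
  assumes u: "norm u \<le> 1" and v: "norm v \<le> 1" and s: "0 \<le> s" "s \<le> 1" and \<delta>: "0 < \<delta>" "\<delta> \<le> 1"
    and tilted: "norm (u + (\<delta> * s) *\<^sub>R v) \<ge> 1 + \<delta> - \<delta> * \<kappa>" and \<kappa>: "\<kappa> < 1"
  shows "norm (u + v) \<ge> 2 - \<kappa>" and "s \<ge> 1 - \<kappa>"
proof -
  have ds: "0 \<le> \<delta> * s" "\<delta> * s \<le> 1"
    using s \<delta> by (auto simp: mult_le_one)
  have "u + (\<delta> * s) *\<^sub>R v = (\<delta> * s) *\<^sub>R (u + v) + (1 - \<delta> * s) *\<^sub>R u"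
    by (simp add: algebra_simps)
  then have "norm (u + (\<delta> * s) *\<^sub>R v) \<le> \<delta> * s * norm (u + v) + (1 - \<delta> * s) * norm u"
    using ds by (metis abs_of_nonneg diff_ge_0_iff_ge norm_scaleR norm_triangle_ineq)
  also have "\<dots> \<le> \<delta> * s * norm (u + v) + (1 - \<delta> * s)"
    using u ds by (simp add: mult_left_le)
  finally have "\<delta> * (1 - \<kappa>) \<le> \<delta> * (s * (norm (u + v) - 1))"
    using tilted by (simp add: algebra_simps)
  then have *: "1 - \<kappa> \<le> s * (norm (u + v) - 1)"
    using \<delta> by simp
  then have "s * (norm (u + v) - 1) > 0"
    using \<kappa> by linarith
  then have "norm (u + v) - 1 > 0"
    using s by (simp add: zero_less_mult_iff)
  then have "s * (norm (u + v) - 1) \<le> 1 * (norm (u + v) - 1)"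
    using s by (intro mult_right_mono) auto
  from order_trans[OF * this] show "norm (u + v) \<ge> 2 - \<kappa>"
    by simp
  have "norm (u + (\<delta> * s) *\<^sub>R v) \<le> 1 + \<delta> * s * 1"
    using ds u v s \<delta>
    by (metis abs_of_nonneg add_mono mult_left_mono norm_scaleR norm_triangle_le)
  then have "\<delta> * (1 - \<kappa>) \<le> \<delta> * s"
    using tilted by (simp add: algebra_simps)
  then show "s \<ge> 1 - \<kappa>"
    using \<delta> by simp
qed

section \<open>Limits along ultrafilters\<close>

text \<open>
  Among the proper filters below \<open>F\<close>, ordered by refinement, chains are bounded by their infimum; a
  maximally fine one decides every predicate.
\<close>

lemma ultrafilter_exists:
  assumes "F \<noteq> bot"
  obtains U where "U \<le> F" "U \<noteq> bot" "\<And>P. eventually P U \<or> eventually (\<lambda>i. \<not> P i) U"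
proof -
  let ?A = "{G. G \<le> F \<and> G \<noteq> bot}" and ?R = "\<lambda>G H. H \<le> (G :: 'a filter)"
  have "\<exists>U\<in>?A. \<forall>G\<in>?A. G \<le> U \<longrightarrow> G = U"
  proof (rule predicate_Zorn)
    show "partial_order_on ?A (relation_of ?R ?A)"
      by (rule partial_order_on_relation_ofI) auto
    fix C assume "C \<in> Chains (relation_of ?R ?A)"
    then have C: "C \<subseteq> ?A" "\<And>G H. G \<in> C \<Longrightarrow> H \<in> C \<Longrightarrow> G \<le> H \<or> H \<le> G"
      unfolding Chains_def relation_of_def by blast+
    show "\<exists>U\<in>?A. \<forall>G\<in>C. U \<le> G"
    proof (cases "C = {}")
      case True
      then show ?thesis using assms by auto
    next
      case False
      have "eventually P (Inf C) \<longleftrightarrow> (\<exists>G\<in>C. eventually P G)" for P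
        by (rule eventually_Inf_base[OF False]) (metis C(2) inf.absorb1 inf.absorb2 order_refl)
      then have "Inf C \<noteq> bot"
        using C(1) by (force simp: trivial_limit_def)
      moreover have "Inf C \<le> F"
        using False C(1) by (auto intro: Inf_lower2)
      ultimately show ?thesis
        by (auto intro: Inf_lower)
    qed
  qed
  then obtain U where U: "U \<le> F" "U \<noteq> bot" and min: "\<And>G. G \<le> U \<Longrightarrow> G \<noteq> bot \<Longrightarrow> G = U"
    by (auto intro: order_trans)
  have "eventually P U \<or> eventually (\<lambda>i. \<not> P i) U" for P
  proof (cases "inf U (principal {i. P i}) = bot")
    case True
    then show ?thesis
      by (simp add: trivial_limit_def eventually_inf_principal)
  next
    case False
    then have "inf U (principal {i. P i}) = U"
      by (intro min) auto
    then have "U \<le> principal {i. P i}"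
      by (metis inf.cobounded2)
    then show ?thesis
      by (simp add: le_principal)
  qed
  then show thesis
    using that U by blast
qed

text \<open>
  Compactness of an interval gives a cluster point of the image filter, and an ultrafilter converges
  to each of its cluster points.
\<close>

lemma ultrafilter_bounded_convergent:
  fixes f :: "'i \<Rightarrow> real"
  assumes U: "U \<noteq> bot" "\<And>P. eventually P U \<or> eventually (\<lambda>i. \<not> P i) U"
    and f: "eventually (\<lambda>i. \<bar>f i\<bar> \<le> c) U"
  shows "(f \<longlongrightarrow> Lim U f) U"
proof -
  have "filtermap f U \<noteq> bot"
    using U(1) by (simp add: filtermap_bot_iff)
  moreover have "eventually (\<lambda>y. y \<in> {-c..c}) (filtermap f U)"
    using f by (simp add: eventually_filtermap abs_le_iff) (auto elim: eventually_mono)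
  ultimately obtain y where y: "inf (nhds y) (filtermap f U) \<noteq> bot"
    using compact_Icc[of "-c" c] unfolding compact_filter by blast
  have "(f \<longlongrightarrow> y) U"
  proof (rule topological_tendstoI)
    fix S assume S: "open S" "y \<in> S"
    have "\<not> eventually (\<lambda>i. f i \<notin> S) U"
    proof
      assume "eventually (\<lambda>i. f i \<notin> S) U"
      then have "eventually (\<lambda>z. z \<notin> S) (filtermap f U)"
        by (simp add: eventually_filtermap)
      moreover have "eventually (\<lambda>z. z \<in> S) (nhds y)"
        using S by (rule eventually_nhds_in_open)
      ultimately have "eventually (\<lambda>z. False) (inf (nhds y) (filtermap f U))"
        unfolding eventually_inf by blast
      then show False
        using y by (simp add: trivial_limit_def)
    qed
    then show "eventually (\<lambda>i. f i \<in> S) U"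
      using U(2) by blast
  qed
  then show ?thesis
    using tendsto_Lim[OF U(1)] by blast
qed

section \<open>Function algebras modulo a filter\<close>

text \<open>
  \<open>E\<close> is a set of functions in which two functions count as equal if they agree eventually along \<open>F\<close>,
  and the norm of \<open>f\<close> is the infimum of the \<open>c\<close> with \<open>\<bar>f\<bar> \<le> c\<close> eventually. A principal filter gives a supremum norm,
  the almost everywhere filter an essential supremum. Restricting a function to a subset of its
  domain amounts to refining the filter.
\<close>

definition fball :: "('i \<Rightarrow> real) set \<Rightarrow> 'i filter \<Rightarrow> ('i \<Rightarrow> real) set" where
  "fball E F = {f \<in> E. eventually (\<lambda>i. \<bar>f i\<bar> \<le> 1) F}"

definition linear_map :: "('i \<Rightarrow> real) set \<Rightarrow> (('i \<Rightarrow> real) \<Rightarrow> 'y::real_normed_vector) \<Rightarrow> bool" where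
  "linear_map E L \<longleftrightarrow>
     (\<forall>f\<in>E. \<forall>g\<in>E. L (\<lambda>i. f i + g i) = L f + L g) \<and> (\<forall>c. \<forall>f\<in>E. L (\<lambda>i. c * f i) = c *\<^sub>R L f)"

definition bounded_map ::
    "('i \<Rightarrow> real) set \<Rightarrow> 'i filter \<Rightarrow> real \<Rightarrow> (('i \<Rightarrow> real) \<Rightarrow> 'y::real_normed_vector) \<Rightarrow> bool" where
  "bounded_map E F C L \<longleftrightarrow> linear_map E L \<and> (\<forall>f\<in>fball E F. norm (L f) \<le> C)"

lemma linear_map_add:
  "linear_map E L \<Longrightarrow> f \<in> E \<Longrightarrow> g \<in> E \<Longrightarrow> L (\<lambda>i. f i + g i) = L f + L g"
  and linear_map_scale: "linear_map E L \<Longrightarrow> f \<in> E \<Longrightarrow> L (\<lambda>i. c * f i) = c *\<^sub>R L f"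
  by (auto simp: linear_map_def)

locale function_algebra =
  fixes E :: "('i \<Rightarrow> real) set" and F :: "'i filter"
  assumes add_closed: "f \<in> E \<Longrightarrow> g \<in> E \<Longrightarrow> (\<lambda>i. f i + g i) \<in> E"
    and scale_closed: "f \<in> E \<Longrightarrow> (\<lambda>i. c * f i) \<in> E"
    and mult_closed: "f \<in> E \<Longrightarrow> g \<in> E \<Longrightarrow> (\<lambda>i. f i * g i) \<in> E"
    and eventually_bounded: "f \<in> E \<Longrightarrow> \<exists>C. eventually (\<lambda>i. \<bar>f i\<bar> \<le> C) F"
begin

lemma diff_closed: "f \<in> E \<Longrightarrow> g \<in> E \<Longrightarrow> (\<lambda>i. f i - g i) \<in> E"
  using add_closed[of f "\<lambda>i. -1 * g i"] scale_closed[of g "-1"] by simp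

lemma function_algebra_le: "G \<le> F \<Longrightarrow> function_algebra E G"
  by unfold_locales
    (use add_closed scale_closed mult_closed eventually_bounded in \<open>blast intro: filter_leD\<close>)+

lemma linear_map_diff:
  assumes "linear_map E L" "f \<in> E" "g \<in> E"
  shows "L (\<lambda>i. f i - g i) = L f - L g"
proof -
  have "L (\<lambda>i. f i + -1 * g i) = L f + (-1) *\<^sub>R L g"
    using assms scale_closed[of g "-1"] unfolding linear_map_def by metis
  then show ?thesis by simp
qed

text \<open>
  Homogeneity is applied with a radius slightly above \<open>c\<close>, so that the case \<open>c = 0\<close> is covered; this
  case says that bounded maps respect eventual equality.
\<close>

lemma bounded_map_le:
  assumes L: "bounded_map E F C L" and f: "f \<in> E" "eventually (\<lambda>i. \<bar>f i\<bar> \<le> c) F" "c \<ge> 0"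
  shows "norm (L f) \<le> C * c"
proof (rule field_le_epsilon)
  have "(\<lambda>i. 0 * f i) \<in> fball E F"
    using scale_closed[OF f(1), of 0] by (simp add: fball_def)
  then have C: "C \<ge> 0"
    using L norm_ge_zero order_trans unfolding bounded_map_def by blast
  fix e :: real assume e: "e > 0"
  \<comment> \<open>The summand 1 guards against a vanishing bound C.\<close>
  define d where "d = c + e / (C + 1)"
  have d: "d > 0" "d \<ge> c"
    using e C f(3) by (auto simp: d_def add_nonneg_pos)
  have "eventually (\<lambda>i. \<bar>1 / d * f i\<bar> \<le> 1) F"
    using f(2) by eventually_elim (use d in \<open>auto simp: abs_mult divide_simps\<close>)
  then have "norm (L (\<lambda>i. 1 / d * f i)) \<le> C"
    using L scale_closed[OF f(1), of "1 / d"] unfolding bounded_map_def fball_def by blast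
  moreover have "L (\<lambda>i. 1 / d * f i) = (1 / d) *\<^sub>R L f"
    using L f(1) unfolding bounded_map_def linear_map_def by blast
  ultimately have "norm (L f) \<le> C * d"
    using d by (simp add: divide_simps)
  also have "\<dots> = C * c + C / (C + 1) * e"
    by (simp add: d_def algebra_simps)
  also have "C / (C + 1) * e \<le> 1 * e"
    using C e by (intro mult_right_mono) auto
  finally show "norm (L f) \<le> C * c + e"
    by simp
qed

lemma bounded_map_cong:
  assumes L: "bounded_map E F C L" and fg: "f \<in> E" "g \<in> E" "eventually (\<lambda>i. f i = g i) F"
  shows "L f = L g"
proof -
  have "eventually (\<lambda>i. \<bar>f i - g i\<bar> \<le> 0) F"
    using fg(3) by eventually_elim simp
  then have "norm (L (\<lambda>i. f i - g i)) \<le> C * 0"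
    using bounded_map_le[OF L diff_closed[OF fg(1,2)], of 0] by blast
  then show ?thesis
    using L linear_map_diff[of L f g] fg(1,2) unfolding bounded_map_def by simp
qed

lemma fball_mult:
  assumes "f \<in> fball E F" "g \<in> fball E F"
  shows "(\<lambda>i. f i * g i) \<in> fball E F"
proof -
  have "eventually (\<lambda>i. \<bar>f i\<bar> \<le> 1) F" "eventually (\<lambda>i. \<bar>g i\<bar> \<le> 1) F"
    using assms by (auto simp: fball_def)
  then have "eventually (\<lambda>i. \<bar>f i * g i\<bar> \<le> 1) F"
    by eventually_elim (simp add: abs_mult mult_le_one)
  then show ?thesis
    using assms mult_closed by (auto simp: fball_def)
qed

text \<open>
  The limit along an ultrafilter is a norm one functional that takes the value \<open>c\<close> at every function
  eventually equal to \<open>c\<close>. It plays the part of a point evaluation, uniformly for spaces with and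
  without points, and thereby also of the Hahn-Banach theorem.
\<close>

lemma ultralimit_functional:
  assumes "F \<noteq> bot"
  obtains \<nu> :: "('i \<Rightarrow> real) \<Rightarrow> real" where "bounded_map E F 1 \<nu>"
    "\<And>f c. eventually (\<lambda>i. f i = c) F \<Longrightarrow> \<nu> f = c"
proof -
  from ultrafilter_exists[OF assms] obtain U where U: "U \<le> F" "U \<noteq> bot"
    "\<And>P. eventually P U \<or> eventually (\<lambda>i. \<not> P i) U" by blast
  have lim: "(f \<longlongrightarrow> Lim U f) U" if f: "f \<in> E" for f
  proof -
    obtain C where "eventually (\<lambda>i. \<bar>f i\<bar> \<le> C) F"
      using eventually_bounded[OF f] by blast
    then show ?thesis
      using U ultrafilter_bounded_convergent filter_leD by metis
  qed
  have eq: "Lim U f = c" if "(f \<longlongrightarrow> c) U" for f :: "'i \<Rightarrow> real" and c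
    using tendsto_Lim[OF U(2) that] .
  have "linear_map E (Lim U)"
    unfolding linear_map_def real_scaleR_def
    by (intro conjI ballI allI eq tendsto_intros lim)
  moreover have "\<bar>Lim U f\<bar> \<le> 1" if f: "f \<in> fball E F" for f
  proof (rule tendsto_upperbound)
    show "((\<lambda>i. \<bar>f i\<bar>) \<longlongrightarrow> \<bar>Lim U f\<bar>) U"
      using lim f by (intro tendsto_intros) (auto simp: fball_def)
    show "eventually (\<lambda>i. \<bar>f i\<bar> \<le> 1) U"
      using f U(1) by (auto simp: fball_def intro: filter_leD)
  qed (use U in auto)
  moreover have "Lim U f = c" if "eventually (\<lambda>i. f i = c) F" for f :: "'i \<Rightarrow> real" and c
    using filter_leD[OF U(1) that] by (intro eq tendsto_eventually)
  ultimately show thesis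
    using that[of "Lim U"] by (auto simp: bounded_map_def)
qed

text \<open>
  The points \<open>m + h\<close> and \<open>m - h\<close> lie in the ball and their images have the midpoint \<open>L m\<close> of nearly
  maximal norm, so uniform convexity makes the images close: an operator that nearly attains its
  norm at \<open>m\<close> is small on every function that fits into the room \<open>1 - \<bar>m\<bar>\<close> left by \<open>m\<close>.
\<close>

lemma small_off_norming:
  fixes L :: "('i \<Rightarrow> real) \<Rightarrow> 'y::real_normed_vector"
  assumes L: "bounded_map E F 1 L" and gap: "convexity_gap TYPE('y) \<epsilon> \<delta>"
    and mh: "m \<in> E" "h \<in> E" "eventually (\<lambda>i. \<bar>m i\<bar> + \<bar>h i\<bar> \<le> 1) F"
    and norming: "2 * norm (L m) > 2 - \<delta>"
  shows "2 * norm (L h) < \<epsilon>"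
proof -
  have "(\<lambda>i. m i + h i) \<in> fball E F" "(\<lambda>i. m i - h i) \<in> fball E F"
    using mh add_closed diff_closed unfolding fball_def by (auto elim!: eventually_mono)
  moreover have "L (\<lambda>i. m i + h i) = L m + L h" "L (\<lambda>i. m i - h i) = L m - L h"
    using L mh linear_map_diff[of L m h] unfolding bounded_map_def linear_map_def by blast+
  ultimately have "norm (L m + L h) \<le> 1" "norm (L m - L h) \<le> 1"
    using L unfolding bounded_map_def by metis+
  moreover have "(L m + L h) + (L m - L h) = 2 *\<^sub>R L m" "(L m + L h) - (L m - L h) = 2 *\<^sub>R L h"
    by (simp_all add: scaleR_2)
  ultimately show ?thesis
    using convexity_gapD[OF gap, of "L m + L h" "L m - L h"] norming by simp
qed

end

section \<open>Creating an operator that attains its norm\<close>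

text \<open>
  The unit is only required to equal 1 eventually, because it will be a truncated element of an
  algebra without constants, such as the null sequences, over a refined filter.
\<close>

locale unital_function_algebra = function_algebra +
  fixes e :: "'i \<Rightarrow> real"
  assumes e: "e \<in> E" "eventually (\<lambda>i. e i = 1) F" and proper: "F \<noteq> bot"
begin

lemma e_in_fball: "e \<in> fball E F"
  using e unfolding fball_def by (auto elim: eventually_mono)

text \<open>
  Tilt \<open>V\<close> to \<open>S = V + \<delta> \<nu>(\<cdot>) V e\<close> with a norm one functional \<open>\<nu>\<close> such that \<open>\<nu> e = 1\<close>, choose \<open>g\<close> at which \<open>S\<close>
  attains its norm up to \<open>\<eta>'\<close>, and put \<open>V' f = S (g f)\<close>, rescaled. Then \<open>V' e\<close> is \<open>S g\<close> up to the scaling, so the defect of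
  \<open>V'\<close> at \<open>e\<close> is as small as desired, independently of how close \<open>V'\<close> must be to \<open>V\<close>. The closeness comes
  from the tilt: it forces \<open>V g\<close> to be near \<open>V e\<close>, hence \<open>V\<close> nearly attains its norm at \<open>m = (g + e) / 2\<close>,
  and \<open>1 - \<bar>m\<bar> = (1 - g) / 2\<close> wherever \<open>e = 1\<close>, so \<open>V\<close> is small at \<open>(1 - g) f / 2\<close> for every \<open>f\<close> in the
  ball. No sign pattern or support has to be cut out.
\<close>

lemma improve_attainment:
  fixes V :: "('i \<Rightarrow> real) \<Rightarrow> 'y::real_normed_vector"
  assumes V: "bounded_map E F 1 V"
    and gap: "convexity_gap TYPE('y) (\<epsilon> / 2) \<kappa>" and eps: "0 < \<epsilon>" "\<epsilon> \<le> 1"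
    and eta: "0 < \<eta>" "16 * \<eta> < \<epsilon>" "16 * \<eta> < \<epsilon> * \<kappa>" and Ve: "norm (V e) \<ge> 1 - \<eta>"
    and "\<eta>' > 0"
  shows "\<exists>V'. bounded_map E F 1 V' \<and> norm (V' e) \<ge> 1 - \<eta>' \<and>
    (\<forall>f\<in>fball E F. norm (V' f - V f) \<le> \<epsilon>)"
proof -
  obtain \<nu> :: "('i \<Rightarrow> real) \<Rightarrow> real" where \<nu>: "bounded_map E F 1 \<nu>"
    and \<nu>1: "\<And>f c. eventually (\<lambda>i. f i = c) F \<Longrightarrow> \<nu> f = c"
    using ultralimit_functional[OF proper] by blast
  \<comment> \<open>The rescaling and the tilt move the operator by at most \<open>\<delta>\<close> each, which leaves \<open>\<epsilon> / 2\<close> for the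
    multiplication by \<open>g\<close>. The defect of \<open>V g + V e\<close> will be \<open>4 \<eta> / \<delta> = 16 \<eta> / \<epsilon>\<close>.\<close>
  define \<delta> where "\<delta> = \<epsilon> / 4"
  have \<delta>: "0 < \<delta>" "\<delta> \<le> 1/4" "4 * \<eta> < \<delta>" "4 * \<eta> < \<delta> * \<kappa>"
    using eps eta by (auto simp: \<delta>_def)
  define S where "S f = V f + (\<delta> * \<nu> f) *\<^sub>R V e" for f
  have S_lin: "linear_map E S"
    using V \<nu> unfolding bounded_map_def linear_map_def S_def by (auto simp: algebra_simps)
  have Vle: "norm (V f) \<le> 1" and \<nu>le: "\<bar>\<nu> f\<bar> \<le> 1" if "f \<in> fball E F" for f
    using V \<nu> that unfolding bounded_map_def by auto
  have tilt_le: "norm ((\<delta> * \<nu> f) *\<^sub>R V e) \<le> \<delta>" if "f \<in> fball E F" for f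
  proof -
    have "\<bar>\<nu> f\<bar> * norm (V e) \<le> 1 * 1"
      using \<nu>le[OF that] Vle[OF e_in_fball] by (intro mult_mono) auto
    then show ?thesis
      using \<delta>(1) by (simp add: abs_mult mult.assoc mult_left_le)
  qed
  have S_le: "norm (S f) \<le> 1 + \<delta>" if "f \<in> fball E F" for f
    using Vle[OF that] tilt_le[OF that] unfolding S_def by (rule norm_triangle_le[OF add_mono])
  define M where "M = (SUP f\<in>fball E F. norm (S f))"
  have bdd: "bdd_above ((\<lambda>f. norm (S f)) ` fball E F)"
    using S_le by (rule bdd_aboveI2)
  have SM: "norm (S f) \<le> M" if "f \<in> fball E F" for f
    unfolding M_def using that bdd by (rule cSUP_upper)
  have M_le: "M \<le> 1 + \<delta>"
    unfolding M_def using e_in_fball S_le by (intro cSUP_least) auto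
  have "S e = (1 + \<delta>) *\<^sub>R V e"
    using \<nu>1[OF e(2)] by (simp add: S_def algebra_simps)
  then have "(1 + \<delta>) * norm (V e) \<le> M"
    using SM[OF e_in_fball] \<delta> by simp
  moreover have "(1 + \<delta>) * (1 - \<eta>) \<le> (1 + \<delta>) * norm (V e)"
    using Ve \<delta> by (intro mult_left_mono) auto
  moreover have "(1 + \<delta>) * (1 - \<eta>) = 1 + \<delta> - (1 + \<delta>) * \<eta>"
    by (simp add: algebra_simps)
  moreover have "(1 + \<delta>) * \<eta> \<le> 2 * \<eta>"
    using \<delta> eta by (intro mult_right_mono) auto
  ultimately have M_ge: "M \<ge> 1 + \<delta> - 2 * \<eta>"
    by linarith
  then have M: "M \<ge> 1"
    using \<delta> eta by linarith
  \<comment> \<open>The bound by \<open>\<eta>\<close> keeps \<open>S g\<close> long enough for the comparison with \<open>V e\<close> when \<open>\<eta>'\<close> is large.\<close>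
  define \<tau> where "\<tau> = min \<eta> \<eta>'"
  have \<tau>: "\<tau> > 0" "\<tau> \<le> \<eta>" "\<tau> \<le> \<eta>'"
    using eta \<open>\<eta>' > 0\<close> by (auto simp: \<tau>_def)
  have "M * (1 - \<tau>) < M"
    using M \<tau> by simp
  then obtain g0 where g0: "g0 \<in> fball E F" "norm (S g0) > M * (1 - \<tau>)"
    unfolding M_def using less_cSUP_iff[OF _ bdd] e_in_fball by blast
  obtain g where g: "g \<in> fball E F" "norm (S g) > M * (1 - \<tau>)" "\<nu> g \<ge> 0"
  proof (cases "\<nu> g0 \<ge> 0")
    case True
    then show ?thesis using that g0 by blast
  next
    case False
    have g0E: "g0 \<in> E"
      using g0 by (simp add: fball_def)
    have "(\<lambda>i. -1 * g0 i) \<in> fball E F"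
      using g0(1) scale_closed[OF g0E, of "-1"] by (simp add: fball_def)
    moreover have "S (\<lambda>i. -1 * g0 i) = (-1) *\<^sub>R S g0" "\<nu> (\<lambda>i. -1 * g0 i) = (-1) *\<^sub>R \<nu> g0"
      using S_lin \<nu> g0E unfolding linear_map_def bounded_map_def by blast+
    ultimately show ?thesis
      using that[of "\<lambda>i. -1 * g0 i"] g0 False by simp
  qed
  have gE: "g \<in> E" and g1: "eventually (\<lambda>i. \<bar>g i\<bar> \<le> 1) F"
    using g(1) by (auto simp: fball_def)
  have "M * \<tau> \<le> 2 * \<eta>"
    using M_le M \<tau> \<delta> by (intro mult_mono) auto
  then have Sg: "norm (S g) \<ge> 1 + \<delta> - 4 * \<eta>"
    using g(2) M_ge by (simp add: algebra_simps)
  have Vge: "norm (V g + V e) \<ge> 2 - 4 * \<eta> / \<delta>"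
    using norm_sum_ge_of_tilted(1)[of "V g" "V e" "\<nu> g" \<delta> "4 * \<eta> / \<delta>"]
      Vle[OF g(1)] Vle[OF e_in_fball] \<nu>le[OF g(1)] g(3) \<delta> Sg by (simp add: S_def)
  define V' where "V' f = (1 / M) *\<^sub>R S (\<lambda>i. g i * f i)" for f
  have gf: "(\<lambda>i. g i * f i) \<in> fball E F" if "f \<in> fball E F" for f
    using fball_mult[OF g(1) that] .
  have "bounded_map E F 1 V'"
    unfolding bounded_map_def linear_map_def
  proof (intro conjI ballI allI)
    fix f h assume fh: "f \<in> E" "h \<in> E"
    have "S (\<lambda>i. g i * f i + g i * h i) = S (\<lambda>i. g i * f i) + S (\<lambda>i. g i * h i)"
      by (rule linear_map_add[OF S_lin mult_closed[OF gE fh(1)] mult_closed[OF gE fh(2)]])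
    then show "V' (\<lambda>i. f i + h i) = V' f + V' h"
      by (simp add: V'_def algebra_simps)
  next
    fix c f assume f: "f \<in> E"
    have "S (\<lambda>i. c * (g i * f i)) = c *\<^sub>R S (\<lambda>i. g i * f i)"
      by (rule linear_map_scale[OF S_lin mult_closed[OF gE f]])
    then show "V' (\<lambda>i. c * f i) = c *\<^sub>R V' f"
      by (simp add: V'_def algebra_simps)
  next
    fix f assume "f \<in> fball E F"
    then show "norm (V' f) \<le> 1"
      using SM[OF gf] M by (simp add: V'_def)
  qed
  moreover have "norm (V' e) \<ge> 1 - \<eta>'"
  proof -
    have "S (\<lambda>i. g i * e i) = S g"
    proof (rule bounded_map_cong)
      show "bounded_map E F (1 + \<delta>) S"
        using S_lin S_le by (simp add: bounded_map_def)
      show "eventually (\<lambda>i. g i * e i = g i) F"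
        using e(2) by eventually_elim simp
    qed (use gE mult_closed[OF gE e(1)] in auto)
    then have "norm (V' e) = norm (S g) / M"
      using M by (simp add: V'_def)
    also have "\<dots> \<ge> 1 - \<tau>"
      using g(2) M by (simp add: field_simps)
    finally show ?thesis
      using \<tau> by linarith
  qed
  moreover have "norm (V' f - V f) \<le> \<epsilon>" if f: "f \<in> fball E F" for f
  proof -
    let ?gf = "\<lambda>i. g i * f i"
    have fE: "f \<in> E" and f1: "eventually (\<lambda>i. \<bar>f i\<bar> \<le> 1) F"
      using f by (auto simp: fball_def)
    \<comment> \<open>The difference \<open>V f - V (g f)\<close> equals \<open>2 V h\<close>, where \<open>h\<close> fits into the room left by \<open>m\<close>.\<close>
    define m where "m = (\<lambda>i. (1/2) * (g i + e i))"
    define h where "h = (\<lambda>i. (1/2) * (f i - g i * f i))"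
    have mh: "m \<in> E" "h \<in> E"
      unfolding m_def h_def
      by (intro scale_closed add_closed diff_closed mult_closed gE e(1) fE)+
    have Vm: "V m = (1/2) *\<^sub>R (V g + V e)"
      using V gE e(1) add_closed[OF gE e(1)] unfolding m_def bounded_map_def linear_map_def by metis
    have Vh: "V h = (1/2) *\<^sub>R (V f - V ?gf)"
      using V linear_map_diff[OF _ fE mult_closed[OF gE fE], of V] diff_closed[OF fE mult_closed[OF gE fE]]
      unfolding h_def bounded_map_def linear_map_def by metis
    have "2 * norm (V h) < \<epsilon> / 2"
    proof (rule small_off_norming[OF V gap mh])
      show "eventually (\<lambda>i. \<bar>m i\<bar> + \<bar>h i\<bar> \<le> 1) F"
        using g1 f1 e(2)
      proof eventually_elim
        case (elim i)
        have "\<bar>(1 - g i) * f i\<bar> \<le> 1 - g i"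
          using elim by (simp add: abs_mult mult_left_le)
        moreover have "h i = (1 - g i) * f i / 2"
          by (simp add: h_def algebra_simps)
        ultimately have "\<bar>h i\<bar> \<le> (1 - g i) / 2"
          by simp
        moreover have "\<bar>m i\<bar> = (1 + g i) / 2"
          using elim by (simp add: m_def)
        ultimately show ?case
          by argo
      qed
      have "4 * \<eta> / \<delta> < \<kappa>"
        using \<delta> by (simp add: field_simps)
      then show "2 * norm (V m) > 2 - \<kappa>"
        using Vge by (simp add: Vm)
    qed
    then have third: "norm (V ?gf - V f) \<le> \<epsilon> / 2"
      by (simp add: Vh norm_minus_commute)
    have "V' f - S ?gf = (1 / M - 1) *\<^sub>R S ?gf"
      by (simp add: V'_def algebra_simps)
    then have "norm (V' f - S ?gf) \<le> \<bar>1 / M - 1\<bar> * M"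
      using SM[OF gf[OF f]] by (simp add: mult_left_mono)
    also have "\<dots> = M - 1"
      using M by (simp add: abs_if field_simps)
    finally have first: "norm (V' f - S ?gf) \<le> \<delta>"
      using M_le by linarith
    have second: "norm (S ?gf - V ?gf) \<le> \<delta>"
      using tilt_le[OF gf[OF f]] by (simp add: S_def)
    have split: "V' f - V f = (V' f - S ?gf) + ((S ?gf - V ?gf) + (V ?gf - V f))"
      by simp
    have "norm (V' f - V f) \<le> \<delta> + (\<delta> + \<epsilon> / 2)"
      by (subst split) (intro norm_triangle_mono first second third)
    then show ?thesis
      by (simp add: \<delta>_def)
  qed
  ultimately show ?thesis
    by blast
qed

text \<open>
  Iterating the previous lemma with closeness \<open>\<epsilon> / 2 ^ (n + 1)\<close> gives a Cauchy sequence of operators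
  whose defects at the fixed point \<open>e\<close> tend to 0, because at every step the next defect may be
  prescribed small enough for the step after it. The pointwise limit attains its norm at \<open>e\<close>.
\<close>

lemma norm_attaining_limit:
  fixes V :: "('i \<Rightarrow> real) \<Rightarrow> 'y::banach"
  assumes V: "bounded_map E F 1 V" and eps: "0 < \<epsilon>" "\<epsilon> \<le> 1"
    and gap: "\<And>n. convexity_gap TYPE('y) (\<epsilon> * (1/2) ^ Suc n / 2) (\<kappa> n)"
    and eta: "\<And>n. 0 < \<eta> n" "\<And>n. 16 * \<eta> n < \<epsilon> * (1/2) ^ Suc n"
      "\<And>n. 16 * \<eta> n < \<epsilon> * (1/2) ^ Suc n * \<kappa> n"
    and Ve: "norm (V e) \<ge> 1 - \<eta> 0"
  shows "\<exists>S. bounded_map E F 1 S \<and> norm (S e) = 1 \<and> (\<forall>f\<in>fball E F. norm (S f - V f) \<le> \<epsilon>)"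
proof -
  let ?\<epsilon> = "\<lambda>n. \<epsilon> * (1/2) ^ Suc n"
  have eps_n: "0 < ?\<epsilon> n" "?\<epsilon> n \<le> 1" for n
    using eps by (auto intro!: mult_le_one power_le_one simp del: power_Suc)
  have sums: "?\<epsilon> sums \<epsilon>"
    using sums_mult[OF power_half_series, of \<epsilon>] by simp
  have "\<exists>W. \<forall>n. (bounded_map E F 1 (W n) \<and> norm (W n e) \<ge> 1 - \<eta> n \<and> (n = 0 \<longrightarrow> W n = V)) \<and>
      (\<forall>f\<in>fball E F. norm (W (Suc n) f - W n f) \<le> ?\<epsilon> n)"
  proof (rule dependent_nat_choice)
    show "\<exists>W. bounded_map E F 1 W \<and> norm (W e) \<ge> 1 - \<eta> 0 \<and> (0 = 0 \<longrightarrow> W = V)" for n :: nat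
      using V Ve by auto
  next
    fix W :: "('i \<Rightarrow> real) \<Rightarrow> 'y" and n
    assume W: "bounded_map E F 1 W \<and> norm (W e) \<ge> 1 - \<eta> n \<and> (n = 0 \<longrightarrow> W = V)"
    then show "\<exists>W'. (bounded_map E F 1 W' \<and> norm (W' e) \<ge> 1 - \<eta> (Suc n) \<and> (Suc n = 0 \<longrightarrow> W' = V)) \<and>
        (\<forall>f\<in>fball E F. norm (W' f - W f) \<le> ?\<epsilon> n)"
      using improve_attainment[OF _ gap eps_n eta(1) eta(2) eta(3), of W n "\<eta> (Suc n)"] eta(1) by blast
  qed
  then obtain W where W: "\<And>n. bounded_map E F 1 (W n)" "\<And>n. norm (W n e) \<ge> 1 - \<eta> n" "W 0 = V"
    and step: "\<And>n f. f \<in> fball E F \<Longrightarrow> norm (W (Suc n) f - W n f) \<le> ?\<epsilon> n"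
    by metis
  have W_lin: "linear_map E (W n)" for n
    using W(1) by (simp add: bounded_map_def)
  have summ: "summable (\<lambda>n. W (Suc n) f - W n f)" if f: "f \<in> E" for f
  proof -
    obtain C where C: "eventually (\<lambda>i. \<bar>f i\<bar> \<le> C) F"
      using eventually_bounded[OF f] by blast
    define D where "D = max C 1"
    have D: "D > 0" "eventually (\<lambda>i. \<bar>f i\<bar> \<le> D) F"
      using C by (auto simp: D_def elim!: eventually_mono)
    have "(\<lambda>i. (1 / D) * f i) \<in> fball E F"
      using D(2) scale_closed[OF f, of "1 / D"] D(1)
      by (auto simp: fball_def abs_mult divide_simps elim!: eventually_mono)
    note step[OF this]
    moreover have "W n (\<lambda>i. (1 / D) * f i) = (1 / D) *\<^sub>R W n f" for n
      using linear_map_scale[OF W_lin f] .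
    ultimately have "norm ((1 / D) *\<^sub>R (W (Suc n) f - W n f)) \<le> ?\<epsilon> n" for n
      by (simp add: scaleR_diff_right del: power_Suc)
    then have "norm (W (Suc n) f - W n f) \<le> D * ?\<epsilon> n" for n
      using D(1) by (simp add: divide_simps mult.commute del: power_Suc)
    then show ?thesis
      by (rule summable_comparison_test'[OF sums_summable[OF sums_mult[OF sums, of D]]])
  qed
  define S where "S f = V f + (\<Sum>n. W (Suc n) f - W n f)" for f
  have lim: "(\<lambda>n. W n f) \<longlonglongrightarrow> S f" if f: "f \<in> E" for f
  proof -
    have "(\<lambda>n. V f + (\<Sum>k<n. W (Suc k) f - W k f)) \<longlonglongrightarrow> S f"
      unfolding S_def by (intro tendsto_intros summable_LIMSEQ summ f)
    then show ?thesis
      by (simp add: sum_lessThan_telescope[of "\<lambda>n. W n f"] W(3))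
  qed
  have S_le: "norm (S f) \<le> 1" if f: "f \<in> fball E F" for f
  proof (rule tendsto_upperbound)
    show "(\<lambda>n. norm (W n f)) \<longlonglongrightarrow> norm (S f)"
      using f by (intro tendsto_norm lim) (simp add: fball_def)
    show "\<forall>\<^sub>F n in sequentially. norm (W n f) \<le> 1"
      using W(1) f by (simp add: bounded_map_def)
  qed simp
  have "S (\<lambda>i. f i + g i) = S f + S g" if fg: "f \<in> E" "g \<in> E" for f g
  proof (rule LIMSEQ_unique)
    show "(\<lambda>n. W n (\<lambda>i. f i + g i)) \<longlonglongrightarrow> S (\<lambda>i. f i + g i)"
      using add_closed[OF fg] by (rule lim)
    show "(\<lambda>n. W n (\<lambda>i. f i + g i)) \<longlonglongrightarrow> S f + S g"
      unfolding linear_map_add[OF W_lin fg] by (intro tendsto_add lim fg)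
  qed
  moreover have "S (\<lambda>i. c * f i) = c *\<^sub>R S f" if f: "f \<in> E" for c f
  proof (rule LIMSEQ_unique)
    show "(\<lambda>n. W n (\<lambda>i. c * f i)) \<longlonglongrightarrow> S (\<lambda>i. c * f i)"
      using scale_closed[OF f] by (rule lim)
    show "(\<lambda>n. W n (\<lambda>i. c * f i)) \<longlonglongrightarrow> c *\<^sub>R S f"
      unfolding linear_map_scale[OF W_lin f] by (intro tendsto_intros lim f)
  qed
  ultimately have S: "bounded_map E F 1 S"
    using S_le by (auto simp: bounded_map_def linear_map_def)
  have eta0: "\<eta> \<longlonglongrightarrow> 0"
  proof (rule tendsto_sandwich[of "\<lambda>_. 0" _ _ ?\<epsilon>])
    show "?\<epsilon> \<longlonglongrightarrow> 0"
      using sums summable_LIMSEQ_zero sums_summable by blast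
    show "\<forall>\<^sub>F n in sequentially. 0 \<le> \<eta> n"
      using eta(1) by (intro always_eventually allI less_imp_le)
    have "\<eta> n \<le> ?\<epsilon> n" for n
      using eta(1)[of n] eta(2)[of n] by linarith
    then show "\<forall>\<^sub>F n in sequentially. \<eta> n \<le> ?\<epsilon> n"
      by (intro always_eventually allI)
  qed simp
  have "1 - 0 \<le> norm (S e)"
  proof (rule tendsto_le)
    show "(\<lambda>n. norm (W n e)) \<longlonglongrightarrow> norm (S e)"
      by (intro tendsto_norm lim e)
    show "(\<lambda>n. 1 - \<eta> n) \<longlonglongrightarrow> 1 - 0"
      by (intro tendsto_intros eta0)
    show "\<forall>\<^sub>F n in sequentially. 1 - \<eta> n \<le> norm (W n e)"
      by (intro always_eventually allI W(2))
  qed simp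
  then have "norm (S e) = 1"
    using S_le[OF e_in_fball] by linarith
  moreover have "norm (S f - V f) \<le> \<epsilon>" if f: "f \<in> fball E F" for f
  proof -
    have "norm (\<Sum>n. W (Suc n) f - W n f) \<le> (\<Sum>n. ?\<epsilon> n)"
      using step[OF f] sums_summable[OF sums] by (rule norm_suminf_le)
    then show ?thesis
      using sums_unique[OF sums] by (simp add: S_def del: power_Suc)
  qed
  ultimately show ?thesis
    using S by blast
qed

text \<open>
  One last tilt makes attainment strong. If \<open>R\<close> has nearly maximal norm at \<open>h\<close> and \<open>\<nu> h \<ge> 0\<close>, then \<open>\<nu> h\<close> is
  near 1 and \<open>S h\<close> is near \<open>S e\<close>. The sign condition is arranged by passing to a subsequence on which
  \<open>\<nu>\<close> has constant sign; that sign is the \<open>l\<close> of the conclusion.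
\<close>

lemma tilt_strongly_exposes:
  fixes S :: "('i \<Rightarrow> real) \<Rightarrow> 'y::real_normed_vector"
  assumes S: "bounded_map E F 1 S" and Se: "norm (S e) = 1"
    and uc: "uniformly_convex TYPE('y)" and eps: "0 < \<epsilon>" "\<epsilon> \<le> 1"
  shows "\<exists>R. bounded_map E F 1 R \<and> norm (R e) = 1 \<and> (\<forall>f\<in>fball E F. norm (R f - S f) \<le> \<epsilon>) \<and>
    (\<forall>g. (\<forall>n. g n \<in> fball E F) \<longrightarrow> (\<lambda>n. norm (R (g n))) \<longlonglongrightarrow> 1 \<longrightarrow>
      (\<exists>s :: nat \<Rightarrow> nat. strict_mono s \<and> (\<exists>l\<in>{1, -1 :: real}. (\<lambda>n. R (g (s n))) \<longlonglongrightarrow> l *\<^sub>R R e)))"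
proof -
  obtain \<nu> :: "('i \<Rightarrow> real) \<Rightarrow> real" where \<nu>: "bounded_map E F 1 \<nu>"
    and \<nu>1: "\<And>f c. eventually (\<lambda>i. f i = c) F \<Longrightarrow> \<nu> f = c"
    using ultralimit_functional[OF proper] by blast
  have Sle: "norm (S f) \<le> 1" and \<nu>le: "\<bar>\<nu> f\<bar> \<le> 1" if "f \<in> fball E F" for f
    using S \<nu> that unfolding bounded_map_def by auto
  have \<nu>e: "\<nu> e = 1"
    using \<nu>1[OF e(2)] .
  define \<delta> where "\<delta> = \<epsilon> / 2"
  have \<delta>: "0 < \<delta>" "\<delta> \<le> 1"
    using eps by (auto simp: \<delta>_def)
  define Q where "Q f = S f + (\<delta> * \<nu> f) *\<^sub>R S e" for f
  define R where "R f = (1 / (1 + \<delta>)) *\<^sub>R Q f" for f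
  have R_lin: "linear_map E R"
    using S \<nu> unfolding bounded_map_def linear_map_def R_def Q_def by (auto simp: algebra_simps)
  have tilt_le: "norm ((\<delta> * \<nu> f) *\<^sub>R S e) \<le> \<delta>" if "f \<in> fball E F" for f
    using \<nu>le[OF that] \<delta> by (simp add: abs_mult Se mult_left_le)
  have "norm (Q f) \<le> 1 + \<delta>" if "f \<in> fball E F" for f
    using Sle[OF that] tilt_le[OF that] unfolding Q_def by (rule norm_triangle_le[OF add_mono])
  then have R: "bounded_map E F 1 R"
    using R_lin \<delta> by (simp add: bounded_map_def R_def divide_simps)
  have "S e + \<delta> *\<^sub>R S e = (1 + \<delta>) *\<^sub>R S e"
    by (simp add: algebra_simps)
  then have Re: "R e = S e"
    using \<delta> by (simp add: R_def Q_def \<nu>e)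
  have near: "norm (R f - S f) \<le> \<epsilon>" if f: "f \<in> fball E F" for f
  proof -
    have "S f = (1 / (1 + \<delta>)) *\<^sub>R ((1 + \<delta>) *\<^sub>R S f)"
      using \<delta> by simp
    then have "R f - S f = (1 / (1 + \<delta>)) *\<^sub>R (Q f - (1 + \<delta>) *\<^sub>R S f)"
      unfolding R_def scaleR_diff_right by argo
    also have "Q f - (1 + \<delta>) *\<^sub>R S f = (\<delta> * \<nu> f) *\<^sub>R S e - \<delta> *\<^sub>R S f"
      by (simp add: Q_def algebra_simps)
    finally have "norm (R f - S f) = (1 / (1 + \<delta>)) * norm ((\<delta> * \<nu> f) *\<^sub>R S e - \<delta> *\<^sub>R S f)"
      using \<delta> by simp
    also have "\<dots> \<le> 1 * norm ((\<delta> * \<nu> f) *\<^sub>R S e - \<delta> *\<^sub>R S f)"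
      using \<delta> by (intro mult_right_mono) auto
    also have "\<dots> \<le> norm ((\<delta> * \<nu> f) *\<^sub>R S e) + norm (\<delta> *\<^sub>R S f)"
      unfolding mult_1 by (rule norm_triangle_ineq4)
    also have "\<dots> \<le> \<delta> + \<delta>"
      using tilt_le[OF f] Sle[OF f] \<delta> by (intro add_mono) (auto simp: mult_left_le)
    finally show ?thesis
      by (simp add: \<delta>_def)
  qed
  have exposes: "\<exists>s :: nat \<Rightarrow> nat. strict_mono s \<and> (\<exists>l\<in>{1, -1 :: real}. (\<lambda>n. R (g (s n))) \<longlonglongrightarrow> l *\<^sub>R R e)"
    if g: "\<And>n. g n \<in> fball E F" and norms: "(\<lambda>n. norm (R (g n))) \<longlonglongrightarrow> 1" for g :: "nat \<Rightarrow> 'i \<Rightarrow> real"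
  proof -
    have "infinite ({n. \<nu> (g n) \<ge> 0} \<union> {n. \<nu> (g n) < 0})"
      by (rule infinite_super[of UNIV]) auto
    then have "\<exists>l\<in>{1, -1 :: real}. infinite {n. l * \<nu> (g n) \<ge> 0}"
    proof (subst (asm) finite_Un, elim disjE de_Morgan_conj[THEN iffD1, THEN disjE])
      assume "infinite {n. \<nu> (g n) < 0}"
      moreover have "{n. \<nu> (g n) < 0} \<subseteq> {n. -1 * \<nu> (g n) \<ge> 0}"
        by auto
      ultimately show ?thesis
        using infinite_super by blast
    qed simp
    then obtain l :: real and s :: "nat \<Rightarrow> nat" where l: "l \<in> {1, -1}"
      and s: "strict_mono s" "\<And>n. l * \<nu> (g (s n)) \<ge> 0"
      using infinite_enumerate by (metis (mono_tags, lifting) mem_Collect_eq)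
    have ll: "l * l = 1" "\<bar>l\<bar> = 1"
      using l by auto
    define h where "h n = (\<lambda>i. l * g (s n) i)" for n
    have gE: "g n \<in> E" for n
      using g by (simp add: fball_def)
    have h: "h n \<in> fball E F" for n
      using g[of "s n"] scale_closed[OF gE, of l] ll by (simp add: h_def fball_def abs_mult)
    have Rh: "R (h n) = l *\<^sub>R R (g (s n))" for n
      unfolding h_def by (rule linear_map_scale[OF R_lin gE])
    have \<nu>h: "\<nu> (h n) \<ge> 0" for n
      using linear_map_scale[of E \<nu>, OF _ gE] \<nu> s(2) by (simp add: h_def bounded_map_def)
    have "(\<lambda>n. norm (R (h n))) \<longlonglongrightarrow> 1"
      using LIMSEQ_subseq_LIMSEQ[OF norms s(1)] by (simp add: Rh ll o_def)
    then have "(\<lambda>n. (1 + \<delta>) * norm (R (h n))) \<longlonglongrightarrow> (1 + \<delta>) * 1"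
      by (intro tendsto_intros)
    then have Qh: "(\<lambda>n. norm (Q (h n))) \<longlonglongrightarrow> 1 + \<delta>"
      using \<delta> by (simp add: R_def)
    define \<kappa> where "\<kappa> n = (1 + \<delta> - norm (Q (h n))) / \<delta>" for n
    have "\<kappa> \<longlonglongrightarrow> (1 + \<delta> - (1 + \<delta>)) / \<delta>"
      unfolding \<kappa>_def using \<delta> by (intro tendsto_intros Qh) simp
    then have \<kappa>: "\<kappa> \<longlonglongrightarrow> 0"
      by simp
    then have \<kappa>1: "eventually (\<lambda>n. \<kappa> n < 1) sequentially"
      by (rule order_tendstoD) simp
    have key: "norm (S (h n) + S e) \<ge> 2 - \<kappa> n" "\<nu> (h n) \<ge> 1 - \<kappa> n" if "\<kappa> n < 1" for n
    proof -
      have "norm (S (h n) + (\<delta> * \<nu> (h n)) *\<^sub>R S e) \<ge> 1 + \<delta> - \<delta> * \<kappa> n"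
        using \<delta> by (simp add: \<kappa>_def Q_def)
      note * = norm_sum_ge_of_tilted[OF Sle[OF h] _ \<nu>h _ \<delta> this that]
      show "norm (S (h n) + S e) \<ge> 2 - \<kappa> n" "\<nu> (h n) \<ge> 1 - \<kappa> n"
        using * Se \<nu>le[OF h[of n]] by auto
    qed
    have "(\<lambda>n. \<nu> (h n)) \<longlonglongrightarrow> 1"
    proof (rule tendsto_sandwich)
      show "\<forall>\<^sub>F n in sequentially. 1 - \<kappa> n \<le> \<nu> (h n)"
        using \<kappa>1 by eventually_elim (rule key)
      show "(\<lambda>n. 1 - \<kappa> n) \<longlonglongrightarrow> 1"
        using tendsto_diff[OF tendsto_const \<kappa>, of 1] by simp
      have "\<nu> (h n) \<le> 1" for n
        using \<nu>le[OF h[of n]] by simp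
      then show "\<forall>\<^sub>F n in sequentially. \<nu> (h n) \<le> 1"
        by simp
    qed simp
    moreover have "(\<lambda>n. S (h n)) \<longlonglongrightarrow> S e"
    proof (rule tendstoI)
      fix \<rho> :: real assume "\<rho> > 0"
      then obtain d where d: "convexity_gap TYPE('y) \<rho> d"
        using uniformly_convex_gap[OF uc] by blast
      then have "d > 0"
        by (simp add: convexity_gap_def)
      with \<kappa> have "eventually (\<lambda>n. \<kappa> n < d) sequentially"
        by (rule order_tendstoD)
      with \<kappa>1 show "eventually (\<lambda>n. dist (S (h n)) (S e) < \<rho>) sequentially"
      proof eventually_elim
        case (elim n)
        then have "norm (S (h n) + S e) > 2 - d"
          using key(1)[of n] by linarith
        then show ?case
          using convexity_gapD[OF d Sle[OF h]] Se by (simp add: dist_norm)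
      qed
    qed
    ultimately have "(\<lambda>n. R (h n)) \<longlonglongrightarrow> (1 / (1 + \<delta>)) *\<^sub>R (S e + (\<delta> * 1) *\<^sub>R S e)"
      unfolding R_def Q_def by (intro tendsto_intros)
    then have "(\<lambda>n. R (h n)) \<longlonglongrightarrow> R e"
      by (simp add: R_def Q_def \<nu>e)
    then have "(\<lambda>n. l *\<^sub>R R (h n)) \<longlonglongrightarrow> l *\<^sub>R R e"
      by (intro tendsto_intros)
    then have "(\<lambda>n. R (g (s n))) \<longlonglongrightarrow> l *\<^sub>R R e"
      by (simp add: Rh ll)
    then show ?thesis
      using s(1) l by blast
  qed
  show ?thesis
    using R near exposes Re Se by (intro exI[of _ R]) auto
qed

end

section \<open>The Bishop-Phelps-Bollobas argument\<close>

text \<open>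
  Truncation at a level is the only lattice operation that the argument uses; subtracting it gives
  soft thresholding.
\<close>

locale truncation_algebra = function_algebra E F for E :: "('i \<Rightarrow> real) set" and F +
  assumes truncation_closed: "f \<in> E \<Longrightarrow> c \<ge> 0 \<Longrightarrow> (\<lambda>i. max (-c) (min c (f i))) \<in> E"
begin

text \<open>
  Let \<open>y\<close> be \<open>x\<close> truncated at the level \<open>1 - r\<close>, and write \<open>x = (1 - r) x0 + r z\<close> with \<open>x0 = y / (1 - r)\<close>
  and \<open>z = (x - y) / r\<close>. Both functions lie in the ball, so if \<open>T\<close> nearly attains its norm at \<open>x\<close> then it
  nearly attains it at \<open>z\<close>; and \<open>x0\<close> is the sign of \<open>z\<close> on the set where \<open>z\<close> does not vanish. Over the
  filter refined to this set, \<open>e = x0 * x0\<close> is a unit and \<open>V f = T (z f)\<close> a contraction with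
  \<open>V e = T z\<close>, so it can be moved to an operator \<open>R\<close> that strongly attains its norm at \<open>e\<close>. The
  required operator is \<open>S f = R (x0 f)\<close>. It is close to \<open>V (x0 f) = T (\<bar>z\<bar> f)\<close>, and
  \<open>T ((1 - \<bar>z\<bar>) f)\<close> is small because \<open>T\<close> nearly attains its norm at \<open>z\<close>.
\<close>

lemma bishop_phelps_bollobas:
  assumes uc: "uniformly_convex TYPE('y::banach)" and "\<epsilon> > 0"
  shows "\<exists>\<eta>>0. \<eta> < \<epsilon> \<and> (\<forall>(T :: ('i \<Rightarrow> real) \<Rightarrow> 'y) x.
    bounded_map E F 1 T \<longrightarrow> x \<in> fball E F \<longrightarrow> norm (T x) > 1 - \<eta> \<longrightarrow>
    (\<exists>S x0. bounded_map E F 1 S \<and> x0 \<in> fball E F \<and> norm (S x0) = 1 \<and>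
      (\<forall>f\<in>fball E F. norm (S f - T f) \<le> \<epsilon>) \<and> eventually (\<lambda>i. \<bar>x i - x0 i\<bar> \<le> \<epsilon>) F \<and>
      (\<forall>g. (\<forall>n. g n \<in> fball E F) \<longrightarrow> (\<lambda>n. norm (S (g n))) \<longlonglongrightarrow> 1 \<longrightarrow>
        (\<exists>s :: nat \<Rightarrow> nat. strict_mono s \<and>
          (\<exists>l\<in>{1, -1 :: real}. (\<lambda>n. S (g (s n))) \<longlonglongrightarrow> l *\<^sub>R S x0)))))"
proof -
  define r where "r = min \<epsilon> (1/2)"
  have r: "0 < r" "r \<le> 1/2" "r \<le> \<epsilon>"
    using \<open>\<epsilon> > 0\<close> by (auto simp: r_def)
  have "\<exists>k. convexity_gap TYPE('y) (r / 3 * (1/2) ^ Suc n / 2) k" for n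
    using r by (intro uniformly_convex_gap[OF uc]) simp
  then obtain \<kappa> where \<kappa>: "\<And>n. convexity_gap TYPE('y) (r / 3 * (1/2) ^ Suc n / 2) (\<kappa> n)"
    by metis
  obtain \<kappa>' where \<kappa>': "convexity_gap TYPE('y) (2 * r / 3) \<kappa>'"
    using uniformly_convex_gap[OF uc, of "2 * r / 3"] r by auto
  have pos: "\<kappa> n > 0" "\<kappa>' > 0" for n
    using \<kappa> \<kappa>' by (auto simp: convexity_gap_def)
  \<comment> \<open>The number 17 merely exceeds the factor 16 in \<open>norm_attaining_limit\<close>.\<close>
  define \<theta> where "\<theta> n = min (r / 3 * (1/2) ^ Suc n) (r / 3 * (1/2) ^ Suc n * \<kappa> n) / 17" for n
  have min_less: "min a b / 17 > 0 \<and> 16 * (min a b / 17) < a \<and> 16 * (min a b / 17) < b"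
    if "a > 0" "b > 0" for a b :: real
    using that by (simp add: min_def)
  have "r / 3 * (1/2) ^ Suc n > 0" "r / 3 * (1/2) ^ Suc n * \<kappa> n > 0" for n
    using r pos by simp_all
  note min_less[OF this]
  then have \<theta>: "\<theta> n > 0" "16 * \<theta> n < r / 3 * (1/2) ^ Suc n" "16 * \<theta> n < r / 3 * (1/2) ^ Suc n * \<kappa> n" for n
    unfolding \<theta>_def by blast+
  \<comment> \<open>The defect at \<open>z\<close> is at most \<open>\<eta> / r\<close>, since \<open>z\<close> has weight \<open>r\<close> in the decomposition of \<open>x\<close>.\<close>
  define \<eta> where "\<eta> = r * min (1/2) (min (\<theta> 0) (\<kappa>' / 2))"
  have eta: "0 < \<eta>" "\<eta> / r \<le> 1/2" "\<eta> / r \<le> \<theta> 0" "\<eta> / r \<le> \<kappa>' / 2"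
    using r \<theta>(1)[of 0] pos by (auto simp: \<eta>_def)
  have "\<eta> < \<epsilon>"
    using eta(2) r by (simp add: field_simps)
  show ?thesis
  proof (intro exI[of _ \<eta>] conjI allI impI)
    fix T :: "('i \<Rightarrow> real) \<Rightarrow> 'y" and x
    assume T: "bounded_map E F 1 T" and x: "x \<in> fball E F" and Tx: "norm (T x) > 1 - \<eta>"
    have T_lin: "linear_map E T" and Tle: "\<And>f. f \<in> fball E F \<Longrightarrow> norm (T f) \<le> 1"
      using T by (auto simp: bounded_map_def)
    have xE: "x \<in> E" and x1: "eventually (\<lambda>i. \<bar>x i\<bar> \<le> 1) F"
      using x by (auto simp: fball_def)
    define y where "y = (\<lambda>i. max (-(1 - r)) (min (1 - r) (x i)))"
    define x0 where "x0 = (\<lambda>i. 1 / (1 - r) * y i)"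
    define z where "z = (\<lambda>i. 1 / r * (x i - y i))"
    have yE: "y \<in> E"
      unfolding y_def using r by (intro truncation_closed xE) simp
    have x0E: "x0 \<in> E" and zE: "z \<in> E"
      unfolding x0_def z_def by (intro scale_closed diff_closed xE yE)+
    have decomp: "x = (\<lambda>i. (1 - r) * x0 i + r * z i)"
      using r by (auto simp: x0_def z_def fun_eq_iff)
    have x0_le: "\<bar>x0 i\<bar> \<le> 1" for i
      using r by (auto simp: x0_def y_def abs_le_iff divide_simps)
    have z_cases: "z i = 0 \<or> x0 i = 1 \<and> z i > 0 \<or> x0 i = -1 \<and> z i < 0" for i
    proof -
      consider "\<bar>x i\<bar> \<le> 1 - r" | "x i > 1 - r" | "x i < -(1 - r)"
        by linarith
      then show ?thesis
      proof cases
        case 1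
        then have "y i = x i"
          by (simp add: y_def)
        then show ?thesis
          by (simp add: z_def)
      next
        case 2
        then have "y i = 1 - r"
          using r by (simp add: y_def)
        then show ?thesis
          using r 2 by (simp add: z_def x0_def)
      next
        case 3
        then have "y i = -(1 - r)"
          using r by (simp add: y_def)
        then have "x0 i = -1" "z i < 0"
          using r 3 by (simp_all add: z_def x0_def divide_simps)
        then show ?thesis
          by blast
      qed
    qed
    have zx0: "z i * x0 i = \<bar>z i\<bar>" and zx0x0: "z i * (x0 i * x0 i) = z i"
      and unimodular: "z i \<noteq> 0 \<Longrightarrow> x0 i * x0 i = 1" for i
      using z_cases[of i] by auto
    have z_le: "\<bar>z i\<bar> \<le> 1" if "\<bar>x i\<bar> \<le> 1" for i
    proof -
      have "\<bar>x i - y i\<bar> \<le> r"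
        using that r unfolding y_def by linarith
      then show ?thesis
        using r by (simp add: z_def abs_mult)
    qed
    have x_x0: "\<bar>x i - x0 i\<bar> \<le> r" if "\<bar>x i\<bar> \<le> 1" for i
    proof -
      have "x i - x0 i = r * (z i - x0 i)"
        by (subst decomp) (simp add: algebra_simps)
      moreover have "\<bar>z i - x0 i\<bar> \<le> 1"
        using z_cases[of i] x0_le[of i] z_le[OF that] by auto
      ultimately show ?thesis
        using r by (simp add: abs_mult mult_left_le)
    qed
    have x0_ball: "x0 \<in> fball E F"
      using x0E x0_le by (simp add: fball_def)
    have "T x = (1 - r) *\<^sub>R T x0 + r *\<^sub>R T z"
      by (subst decomp) (simp add: linear_map_add[OF T_lin] linear_map_scale[OF T_lin] scale_closed x0E zE)
    then have "norm (T x) \<le> norm ((1 - r) *\<^sub>R T x0) + norm (r *\<^sub>R T z)"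
      by (simp only: norm_triangle_ineq)
    also have "\<dots> = (1 - r) * norm (T x0) + r * norm (T z)"
      using r by simp
    also have "\<dots> \<le> (1 - r) * 1 + r * norm (T z)"
      using Tle[OF x0_ball] r by (intro add_mono mult_left_mono) auto
    finally have "r * norm (T z) > r - \<eta>"
      using Tx by simp
    then have Tz: "norm (T z) > 1 - \<eta> / r"
      using r by (simp add: field_simps)
    define G where "G = inf F (principal {i. z i \<noteq> 0})"
    define e where "e = (\<lambda>i. x0 i * x0 i)"
    have ev_G: "eventually P G \<longleftrightarrow> eventually (\<lambda>i. z i \<noteq> 0 \<longrightarrow> P i) F" for P
      by (simp add: G_def eventually_inf_principal)
    have fball_G: "f \<in> fball E G" if "f \<in> fball E F" for f
      using that by (auto simp: fball_def ev_G elim: eventually_mono)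
    interpret G: function_algebra E G
      by (rule function_algebra_le) (simp add: G_def)
    interpret G: unital_function_algebra E G e
    proof unfold_locales
      show "e \<in> E"
        unfolding e_def by (rule mult_closed[OF x0E x0E])
      show "eventually (\<lambda>i. e i = 1) G"
        using unimodular by (simp add: ev_G e_def)
      show "G \<noteq> bot"
      proof
        assume "G = bot"
        then have "eventually (\<lambda>i. \<bar>z i\<bar> \<le> 0) F"
          by (simp add: trivial_limit_def ev_G)
        then have "norm (T z) \<le> 1 * 0"
          using bounded_map_le[OF T zE] by blast
        then show False
          using Tz eta(2) by simp
      qed
    qed
    define V where "V f = T (\<lambda>i. z i * f i)" for f
    have "bounded_map E G 1 V"
      unfolding bounded_map_def linear_map_def
    proof (intro conjI ballI allI)
      fix f h assume "f \<in> E" "h \<in> E"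
      then show "V (\<lambda>i. f i + h i) = V f + V h"
        using linear_map_add[OF T_lin mult_closed[OF zE] mult_closed[OF zE]]
        by (simp add: V_def distrib_left)
    next
      fix c f assume "f \<in> E"
      then show "V (\<lambda>i. c * f i) = c *\<^sub>R V f"
        using linear_map_scale[OF T_lin mult_closed[OF zE]] by (simp add: V_def mult.left_commute)
    next
      fix f assume f: "f \<in> fball E G"
      then have "eventually (\<lambda>i. z i \<noteq> 0 \<longrightarrow> \<bar>f i\<bar> \<le> 1) F"
        by (simp add: fball_def ev_G)
      with x1 have "eventually (\<lambda>i. \<bar>z i * f i\<bar> \<le> 1) F"
      proof eventually_elim
        case (elim i)
        then show ?case
          using z_le by (cases "z i = 0") (auto simp: abs_mult mult_le_one)
      qed
      then show "norm (V f) \<le> 1"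
        unfolding V_def using f mult_closed[OF zE] by (intro Tle) (simp add: fball_def)
    qed
    moreover have "norm (V e) \<ge> 1 - \<theta> 0"
      using Tz eta(3) by (simp add: V_def e_def zx0x0)
    ultimately obtain A where A: "bounded_map E G 1 A" "norm (A e) = 1"
      "\<And>f. f \<in> fball E G \<Longrightarrow> norm (A f - V f) \<le> r / 3"
      using G.norm_attaining_limit[OF _ _ _ \<kappa> \<theta>, of V] r by auto
    obtain R where R: "bounded_map E G 1 R" "norm (R e) = 1"
      "\<And>f. f \<in> fball E G \<Longrightarrow> norm (R f - A f) \<le> r / 3"
      and exposes: "\<And>g. (\<And>n. g n \<in> fball E G) \<Longrightarrow> (\<lambda>n. norm (R (g n))) \<longlonglongrightarrow> 1 \<Longrightarrow>
        \<exists>s :: nat \<Rightarrow> nat. strict_mono s \<and> (\<exists>l\<in>{1, -1 :: real}. (\<lambda>n. R (g (s n))) \<longlonglongrightarrow> l *\<^sub>R R e)"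
      using G.tilt_strongly_exposes[OF A(1,2) uc, of "r / 3"] r by auto
    have R_lin: "linear_map E R"
      using R(1) by (simp add: bounded_map_def)
    define S where "S f = R (\<lambda>i. x0 i * f i)" for f
    have x0f: "(\<lambda>i. x0 i * f i) \<in> fball E G" if "f \<in> fball E F" for f
      using that x0_ball by (intro fball_G fball_mult)
    have S: "bounded_map E F 1 S"
      unfolding bounded_map_def linear_map_def
    proof (intro conjI ballI allI)
      fix f h assume "f \<in> E" "h \<in> E"
      then show "S (\<lambda>i. f i + h i) = S f + S h"
        using linear_map_add[OF R_lin mult_closed[OF x0E] mult_closed[OF x0E]]
        by (simp add: S_def distrib_left)
    next
      fix c f assume "f \<in> E"
      then show "S (\<lambda>i. c * f i) = c *\<^sub>R S f"
        using linear_map_scale[OF R_lin mult_closed[OF x0E]] by (simp add: S_def mult.left_commute)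
    next
      fix f assume "f \<in> fball E F"
      then show "norm (S f) \<le> 1"
        using R(1) x0f by (simp add: S_def bounded_map_def)
    qed
    have Sx0: "S x0 = R e"
      by (simp add: S_def e_def)
    have near: "norm (S f - T f) \<le> \<epsilon>" if f: "f \<in> fball E F" for f
    proof -
      let ?k = "\<lambda>i. x0 i * f i"
      have fE: "f \<in> E" and f1: "eventually (\<lambda>i. \<bar>f i\<bar> \<le> 1) F"
        using f by (auto simp: fball_def)
      have zkE: "(\<lambda>i. z i * ?k i) \<in> E"
        by (intro mult_closed zE x0E fE)
      have "2 * norm (T (\<lambda>i. f i - z i * ?k i)) < 2 * r / 3"
      proof (rule small_off_norming[OF T \<kappa>' zE diff_closed[OF fE zkE]])
        show "eventually (\<lambda>i. \<bar>z i\<bar> + \<bar>f i - z i * ?k i\<bar> \<le> 1) F"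
          using x1 f1
        proof eventually_elim
          case (elim i)
          have "f i - z i * ?k i = (1 - \<bar>z i\<bar>) * f i"
            by (simp add: algebra_simps flip: zx0)
          moreover have "\<bar>(1 - \<bar>z i\<bar>) * f i\<bar> \<le> 1 - \<bar>z i\<bar>"
            using elim z_le[of i] by (simp add: abs_mult mult_left_le)
          ultimately show ?case
            by simp
        qed
        show "2 * norm (T z) > 2 - \<kappa>'"
          using Tz eta(4) by simp
      qed
      then have third: "norm (V ?k - T f) \<le> r / 3"
        using linear_map_diff[OF T_lin fE zkE] by (simp add: V_def norm_minus_commute)
      have split: "S f - T f = (R ?k - A ?k) + ((A ?k - V ?k) + (V ?k - T f))"
        by (simp add: S_def)
      have "norm (S f - T f) \<le> r / 3 + (r / 3 + r / 3)"
        by (subst split) (intro norm_triangle_mono R(3)[OF x0f[OF f]] A(3)[OF x0f[OF f]] third)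
      then show ?thesis
        using r by simp
    qed
    show "\<exists>S x0. bounded_map E F 1 S \<and> x0 \<in> fball E F \<and> norm (S x0) = 1 \<and>
      (\<forall>f\<in>fball E F. norm (S f - T f) \<le> \<epsilon>) \<and> eventually (\<lambda>i. \<bar>x i - x0 i\<bar> \<le> \<epsilon>) F \<and>
      (\<forall>g. (\<forall>n. g n \<in> fball E F) \<longrightarrow> (\<lambda>n. norm (S (g n))) \<longlonglongrightarrow> 1 \<longrightarrow>
        (\<exists>s :: nat \<Rightarrow> nat. strict_mono s \<and>
          (\<exists>l\<in>{1, -1 :: real}. (\<lambda>n. S (g (s n))) \<longlonglongrightarrow> l *\<^sub>R S x0)))"
    proof (intro exI[of _ S] exI[of _ x0] conjI ballI allI impI)
      show "eventually (\<lambda>i. \<bar>x i - x0 i\<bar> \<le> \<epsilon>) F"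
        using x1 by eventually_elim (use x_x0 r in force)
      show "norm (S x0) = 1"
        using Sx0 R(2) by simp
      fix g :: "nat \<Rightarrow> 'i \<Rightarrow> real"
      assume "\<forall>n. g n \<in> fball E F" "(\<lambda>n. norm (S (g n))) \<longlonglongrightarrow> 1"
      then show "\<exists>s :: nat \<Rightarrow> nat. strict_mono s \<and>
          (\<exists>l\<in>{1, -1 :: real}. (\<lambda>n. S (g (s n))) \<longlonglongrightarrow> l *\<^sub>R S x0)"
        using exposes[of "\<lambda>n i. x0 i * g n i"] x0f Sx0 unfolding S_def by auto
    qed (use S x0_ball near in auto)
  qed (use eta \<open>\<eta> < \<epsilon>\<close> in auto)
qed

end

section \<open>Transfer to normed spaces given by a carrier\<close>

text \<open>
  The map \<open>q\<close> presents \<open>X\<close> as the quotient of the function algebra by eventual equality: it is the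
  identity for the supremum norm spaces and the passage to classes for \<open>L\<^sub>\<infinity>(\<mu>)\<close>.
\<close>

locale function_model = truncation_algebra E F for E :: "('i \<Rightarrow> real) set" and F +
  fixes X :: "'v nspace" and q :: "('i \<Rightarrow> real) \<Rightarrow> 'v"
  assumes zero_closed: "(\<lambda>i. 0) \<in> E"
    and carr_eq: "carr X = q ` E"
    and vadd_q: "f \<in> E \<Longrightarrow> g \<in> E \<Longrightarrow> vadd X (q f) (q g) = q (\<lambda>i. f i + g i)"
    and vscale_q: "f \<in> E \<Longrightarrow> vscale X c (q f) = q (\<lambda>i. c * f i)"
    and vnorm_q_le_iff: "f \<in> E \<Longrightarrow> vnorm X (q f) \<le> c \<longleftrightarrow> 0 \<le> c \<and> eventually (\<lambda>i. \<bar>f i\<bar> \<le> c) F"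
begin

lemma unit_ball_eq: "unit_ball X = q ` fball E F"
  by (auto simp: unit_ball_def carr_eq fball_def vnorm_q_le_iff)

lemma zero_fball: "(\<lambda>i. 0) \<in> fball E F"
  by (simp add: fball_def zero_closed)

lemma vnorm_q_nonneg: "f \<in> E \<Longrightarrow> 0 \<le> vnorm X (q f)"
  and eventually_le_vnorm: "f \<in> E \<Longrightarrow> eventually (\<lambda>i. \<bar>f i\<bar> \<le> vnorm X (q f)) F"
  using vnorm_q_le_iff[of f "vnorm X (q f)"] by auto

lemma vdiff_q: "f \<in> E \<Longrightarrow> g \<in> E \<Longrightarrow> vdiff X (q f) (q g) = q (\<lambda>i. f i - g i)"
  using vadd_q[of f "\<lambda>i. -1 * g i"] scale_closed[of g "-1"] by (simp add: vdiff_def vscale_q)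

lemma eventually_eq_of_q_eq:
  assumes "f \<in> E" "g \<in> E" "q f = q g"
  shows "eventually (\<lambda>i. f i = g i) F"
proof -
  have "vnorm X (vdiff X (q f) (q f)) \<le> 0"
    using assms(1) zero_closed by (simp add: vdiff_q vnorm_q_le_iff)
  moreover have "vdiff X (q f) (q f) = q (\<lambda>i. f i - g i)"
    using assms vdiff_q[of f g] by simp
  ultimately have "eventually (\<lambda>i. \<bar>f i - g i\<bar> \<le> 0) F"
    using vnorm_q_le_iff[OF diff_closed[OF assms(1,2)]] by simp
  then show ?thesis
    by (auto elim: eventually_mono)
qed

lemma op_norm_le:
  assumes "\<And>f. f \<in> fball E F \<Longrightarrow> norm (T (q f)) \<le> C"
  shows "op_norm X T \<le> C"
  unfolding op_norm_def unit_ball_eq using assms zero_fball by (intro cSUP_least) auto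

lemma norm_le_op_norm:
  assumes T: "T \<in> bounded_ops X" and f: "f \<in> fball E F"
  shows "norm (T (q f)) \<le> op_norm X T"
proof -
  obtain C where C: "\<And>u. u \<in> carr X \<Longrightarrow> norm (T u) \<le> C * vnorm X u"
    using T unfolding bounded_ops_def by blast
  have "norm (T u) \<le> max C 0" if u: "u \<in> unit_ball X" for u
  proof -
    have "0 \<le> vnorm X u" "vnorm X u \<le> 1" "u \<in> carr X"
      using u vnorm_q_nonneg by (auto simp: unit_ball_def carr_eq)
    moreover from this have "C * vnorm X u \<le> max C 0 * 1"
      by (intro mult_mono) auto
    ultimately show ?thesis
      using C[of u] by linarith
  qed
  then have "bdd_above ((\<lambda>u. norm (T u)) ` unit_ball X)"
    by (rule bdd_aboveI2)
  then show ?thesis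
    unfolding op_norm_def using f by (intro cSUP_upper) (auto simp: unit_ball_eq)
qed

lemma bounded_map_of_op:
  assumes "T \<in> bounded_ops X"
  shows "bounded_map E F (op_norm X T) (\<lambda>f. T (q f))"
proof -
  have "linear_map E (\<lambda>f. T (q f))"
    using assms by (auto simp: linear_map_def bounded_ops_def carr_eq simp flip: vadd_q vscale_q)
  then show ?thesis
    using norm_le_op_norm[OF assms] by (simp add: bounded_map_def)
qed

definition lift_map :: "(('i \<Rightarrow> real) \<Rightarrow> 'y) \<Rightarrow> 'v \<Rightarrow> 'y" where
  "lift_map L u = L (SOME f. f \<in> E \<and> q f = u)"

lemma lift_map_q:
  assumes "bounded_map E F C L" "f \<in> E"
  shows "lift_map L (q f) = L f"
proof -
  define h where "h = (SOME h. h \<in> E \<and> q h = q f)"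
  have "h \<in> E \<and> q h = q f"
    unfolding h_def using assms(2) by (intro someI[of "\<lambda>h. h \<in> E \<and> q h = q f"]) simp
  then have "L h = L f"
    using bounded_map_cong[OF assms(1) _ assms(2)] eventually_eq_of_q_eq[OF _ assms(2)] by blast
  then show ?thesis
    by (simp add: lift_map_def h_def)
qed

lemma lift_map_bounded_ops:
  assumes L: "bounded_map E F C L"
  shows "lift_map L \<in> bounded_ops X"
proof -
  have lin: "linear_map E L"
    using L by (simp add: bounded_map_def)
  have "norm (lift_map L (q f)) \<le> C * vnorm X (q f)" if "f \<in> E" for f
    using bounded_map_le[OF L that eventually_le_vnorm[OF that] vnorm_q_nonneg[OF that]]
    by (simp add: lift_map_q[OF L that])
  then show ?thesis
    using lin by (auto simp: bounded_ops_def carr_eq vadd_q vscale_q lift_map_q[OF L] add_closed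
        scale_closed linear_map_add linear_map_scale)
qed

theorem BPBp_RSE_of_uniformly_convex:
  assumes uc: "uniformly_convex TYPE('y::banach)"
  shows "BPBp_RSE X TYPE('y)"
  unfolding BPBp_RSE_def
proof (intro allI impI)
  fix \<epsilon> :: real assume "\<epsilon> > 0"
  then have "\<epsilon> / 2 > 0"
    by simp
  from bishop_phelps_bollobas[OF uc this] obtain \<eta> where \<eta>: "\<eta> > 0" "\<eta> < \<epsilon> / 2" and
    *: "\<And>(T :: ('i \<Rightarrow> real) \<Rightarrow> 'y) x.
    bounded_map E F 1 T \<Longrightarrow> x \<in> fball E F \<Longrightarrow> norm (T x) > 1 - \<eta> \<Longrightarrow>
    (\<exists>S x0. bounded_map E F 1 S \<and> x0 \<in> fball E F \<and> norm (S x0) = 1 \<and>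
      (\<forall>f\<in>fball E F. norm (S f - T f) \<le> \<epsilon> / 2) \<and> eventually (\<lambda>i. \<bar>x i - x0 i\<bar> \<le> \<epsilon> / 2) F \<and>
      (\<forall>g. (\<forall>n. g n \<in> fball E F) \<longrightarrow> (\<lambda>n. norm (S (g n))) \<longlonglongrightarrow> 1 \<longrightarrow>
        (\<exists>s :: nat \<Rightarrow> nat. strict_mono s \<and>
          (\<exists>l\<in>{1, -1 :: real}. (\<lambda>n. S (g (s n))) \<longlonglongrightarrow> l *\<^sub>R S x0))))"
    by blast
  show "\<exists>\<eta>>0. \<eta> < \<epsilon> \<and> (\<forall>T :: 'v \<Rightarrow> 'y. T \<in> bounded_ops X \<longrightarrow> op_norm X T = 1 \<longrightarrow>
       (\<forall>x\<in>unit_sphere X. norm (T x) > 1 - \<eta> \<longrightarrow>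
         (\<exists>S\<in>RSE X. \<exists>x0\<in>unit_sphere X.
            op_norm X S = 1 \<and> norm (S x0) = 1 \<and>
            op_norm X (\<lambda>u. S u - T u) < \<epsilon> \<and> vnorm X (vdiff X x x0) < \<epsilon>)))"
  proof (intro exI[of _ \<eta>] conjI allI impI ballI)
    fix T :: "'v \<Rightarrow> 'y" and u
    assume T: "T \<in> bounded_ops X" "op_norm X T = 1" and u: "u \<in> unit_sphere X" "norm (T u) > 1 - \<eta>"
    obtain x where x: "x \<in> E" "u = q x"
      using u(1) by (auto simp: unit_sphere_def carr_eq)
    have "x \<in> fball E F"
      using u(1) x vnorm_q_le_iff[OF x(1), of 1] by (simp add: unit_sphere_def fball_def)
    then obtain S x0 where S: "bounded_map E F 1 S" and x0: "x0 \<in> fball E F" "norm (S x0) = 1"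
      and near: "\<And>f. f \<in> fball E F \<Longrightarrow> norm (S f - T (q f)) \<le> \<epsilon> / 2"
      "eventually (\<lambda>i. \<bar>x i - x0 i\<bar> \<le> \<epsilon> / 2) F"
      and exposes: "\<And>g. (\<And>n. g n \<in> fball E F) \<Longrightarrow> (\<lambda>n. norm (S (g n))) \<longlonglongrightarrow> 1 \<Longrightarrow>
        \<exists>s :: nat \<Rightarrow> nat. strict_mono s \<and>
          (\<exists>l\<in>{1, -1 :: real}. (\<lambda>n. S (g (s n))) \<longlonglongrightarrow> l *\<^sub>R S x0)"
      using *[of "\<lambda>f. T (q f)" x] bounded_map_of_op[OF T(1)] T(2) u(2) x(2) by auto
    have x0E: "x0 \<in> E"
      using x0 by (simp add: fball_def)
    let ?S = "lift_map S"
    have Sq: "?S (q f) = S f" if "f \<in> fball E F" for f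
      using that lift_map_q[OF S] by (simp add: fball_def)
    have S_ops: "?S \<in> bounded_ops X"
      by (rule lift_map_bounded_ops[OF S])
    have Sx0: "norm (?S (q x0)) = 1"
      using Sq[OF x0(1)] x0(2) by simp
    have S_norm: "op_norm X ?S = 1"
    proof (rule antisym)
      show "op_norm X ?S \<le> 1"
        using S by (intro op_norm_le) (auto simp: Sq bounded_map_def)
      show "1 \<le> op_norm X ?S"
        using norm_le_op_norm[OF S_ops x0(1)] Sx0 by simp
    qed
    have "norm (S x0) \<le> 1 * vnorm X (q x0)"
      by (rule bounded_map_le[OF S x0E eventually_le_vnorm[OF x0E] vnorm_q_nonneg[OF x0E]])
    moreover have "vnorm X (q x0) \<le> 1"
      using x0 by (simp add: vnorm_q_le_iff fball_def)
    ultimately have x0_sphere: "q x0 \<in> unit_sphere X"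
      using x0(2) x0E by (auto simp: unit_sphere_def carr_eq)
    have "\<exists>s :: nat \<Rightarrow> nat. strict_mono s \<and>
          (\<exists>l\<in>{1, -1 :: real}. (\<lambda>n. ?S (v (s n))) \<longlonglongrightarrow> l *\<^sub>R ?S (q x0))"
      if v: "\<forall>n. v n \<in> unit_ball X" "(\<lambda>n. norm (?S (v n))) \<longlonglongrightarrow> op_norm X ?S" for v :: "nat \<Rightarrow> 'v"
    proof -
      have "\<exists>g. \<forall>n. g n \<in> fball E F \<and> v n = q (g n)"
        using v(1) unfolding unit_ball_eq image_iff by (metis (no_types, lifting))
      then obtain g where g: "\<And>n. g n \<in> fball E F" "\<And>n. v n = q (g n)"
        by blast
      show ?thesis
        using exposes[of g] g(1) v(2) by (simp add: S_norm g Sq x0)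
    qed
    then have "?S \<in> RSE X"
      using S_ops x0_sphere by (auto simp: RSE_def)
    moreover have "op_norm X (\<lambda>u. ?S u - T u) < \<epsilon>"
    proof -
      have "op_norm X (\<lambda>u. ?S u - T u) \<le> \<epsilon> / 2"
        using near(1) by (intro op_norm_le) (simp add: Sq)
      then show ?thesis
        using \<open>\<epsilon> > 0\<close> by simp
    qed
    moreover have "vnorm X (vdiff X u (q x0)) < \<epsilon>"
    proof -
      have "vnorm X (q (\<lambda>i. x i - x0 i)) \<le> \<epsilon> / 2"
        unfolding vnorm_q_le_iff[OF diff_closed[OF x(1) x0E]] using near(2) \<open>\<epsilon> > 0\<close> by simp
      then show ?thesis
        using \<open>\<epsilon> > 0\<close> by (simp add: x vdiff_q x0E)
    qed
    ultimately show "\<exists>S\<in>RSE X. \<exists>x0\<in>unit_sphere X.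
            op_norm X S = 1 \<and> norm (S x0) = 1 \<and>
            op_norm X (\<lambda>u. S u - T u) < \<epsilon> \<and> vnorm X (vdiff X u x0) < \<epsilon>"
      using x0_sphere S_norm Sx0 by blast
  qed (use \<eta> in auto)
qed

text \<open>
  All points of the ball at which an RSE operator attains its norm have one of only two images, a
  vector and its negative. The points \<open>g + w\<close> and \<open>g - w\<close> lie in the ball, and since the norm is attained
  at their midpoint it is attained at both. Two of the images at \<open>g\<close>, \<open>g + w\<close> and \<open>g - w\<close> coincide.
\<close>

lemma RSE_vanishes:
  fixes S :: "'v \<Rightarrow> 'y::real_normed_vector"
  assumes S: "S \<in> RSE X" "op_norm X S = 1" and g: "g \<in> E" and w: "w \<in> E"
    and gw: "eventually (\<lambda>i. \<bar>g i\<bar> + \<bar>w i\<bar> \<le> 1) F" and attains: "norm (S (q g)) = 1"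
  shows "S (q w) = 0"
proof -
  have S_ops: "S \<in> bounded_ops X"
    using S(1) by (simp add: RSE_def)
  obtain u where u: "\<And>v. (\<forall>n :: nat. v n \<in> unit_ball X) \<Longrightarrow> (\<lambda>n. norm (S (v n))) \<longlonglongrightarrow> op_norm X S \<Longrightarrow>
      \<exists>s :: nat \<Rightarrow> nat. strict_mono s \<and> (\<exists>l\<in>{1, -1 :: real}. (\<lambda>n. S (v (s n))) \<longlonglongrightarrow> l *\<^sub>R S u)"
    using S(1) unfolding RSE_def by blast
  have two_values: "S (q f) \<in> {S u, - S u}" if f: "f \<in> fball E F" "norm (S (q f)) = 1" for f
  proof -
    have "\<exists>l\<in>{1, -1 :: real}. (\<lambda>n :: nat. S (q f)) \<longlonglongrightarrow> l *\<^sub>R S u"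
      using u[of "\<lambda>_. q f"] f S(2) by (auto simp: unit_ball_eq)
    then show ?thesis
      by (auto simp: LIMSEQ_const_iff)
  qed
  let ?p = "\<lambda>i. g i + w i" and ?m = "\<lambda>i. g i - w i"
  have ball: "g \<in> fball E F" "?p \<in> fball E F" "?m \<in> fball E F"
    using g w gw add_closed diff_closed unfolding fball_def by (auto elim!: eventually_mono)
  note lin = bounded_map_of_op[OF S_ops, unfolded bounded_map_def, THEN conjunct1]
  have vals: "S (q ?p) = S (q g) + S (q w)" "S (q ?m) = S (q g) - S (q w)"
    using linear_map_add[OF lin g w] linear_map_diff[OF lin g w] by auto
  have le: "norm (S (q ?p)) \<le> 1" "norm (S (q ?m)) \<le> 1"
    using norm_le_op_norm[OF S_ops] ball S(2) by metis+
  have "2 *\<^sub>R S (q g) = S (q ?p) + S (q ?m)"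
    by (simp add: vals scaleR_2)
  then have "2 \<le> norm (S (q ?p)) + norm (S (q ?m))"
    using attains norm_triangle_ineq[of "S (q ?p)" "S (q ?m)"]
    by (metis abs_numeral mult.right_neutral norm_scaleR)
  then have "norm (S (q ?p)) = 1" "norm (S (q ?m)) = 1"
    using le by linarith+
  then have "S (q g) \<in> {S u, - S u}" "S (q g) + S (q w) \<in> {S u, - S u}" "S (q g) - S (q w) \<in> {S u, - S u}"
    using two_values ball attains vals by metis+
  moreover have "b = a \<or> c = a \<or> b = c"
    if "a \<in> {v, - v}" "b \<in> {v, - v}" "c \<in> {v, - v}" for a b c v :: 'y
    using that by auto
  ultimately have "S (q g) + S (q w) = S (q g) \<or> S (q g) - S (q w) = S (q g) \<or>
      S (q g) + S (q w) = S (q g) - S (q w)"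
    by blast
  moreover have "S (q w) = 0" if "S (q g) + S (q w) = S (q g) - S (q w)"
  proof -
    have "2 *\<^sub>R S (q w) = (S (q g) + S (q w)) - (S (q g) - S (q w))"
      by (simp add: scaleR_2)
    then show ?thesis
      using that by simp
  qed
  ultimately show ?thesis
    by auto
qed

text \<open>
  For unit vectors \<open>y1\<close>, \<open>y2\<close> with a long midpoint \<open>p\<close> and \<open>d = (y1 - y2) / 2\<close> the operator
  \<open>f \<mapsto> \<alpha>(f) p + \<beta>(f) d\<close>, where \<open>\<alpha>\<close> and \<open>\<beta>\<close> evaluate inside \<open>A\<close> and inside \<open>B\<close>, has norm 1 and nearly attains
  it at the indicator of \<open>A\<close>. An RSE operator attaining its norm near this indicator vanishes at the
  indicator of \<open>B\<close>, hence \<open>d\<close> is short.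
\<close>

theorem uniformly_convex_of_BPBp_RSE:
  assumes bpb: "BPBp_RSE X TYPE('y::real_normed_vector)"
    and AB: "A \<inter> B = {}" "indicat_real A \<in> E" "indicat_real B \<in> E"
    and A: "inf F (principal A) \<noteq> bot" and B: "inf F (principal B) \<noteq> bot"
  shows "uniformly_convex TYPE('y)"
  unfolding uniformly_convex_def
proof (intro allI impI)
  fix \<epsilon> :: real assume "\<epsilon> > 0"
  define \<rho> where "\<rho> = min (\<epsilon> / 2) (1/2)"
  have \<rho>: "0 < \<rho>" "2 * \<rho> \<le> \<epsilon>" "\<rho> \<le> 1/2"
    using \<open>\<epsilon> > 0\<close> by (auto simp: \<rho>_def)
  from bpb[unfolded BPBp_RSE_def, rule_format, OF \<rho>(1)]
  obtain \<eta> where \<eta>: "0 < \<eta>" "\<eta> < \<rho>" and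
    *: "\<forall>T :: 'v \<Rightarrow> 'y. T \<in> bounded_ops X \<longrightarrow> op_norm X T = 1 \<longrightarrow>
       (\<forall>x\<in>unit_sphere X. norm (T x) > 1 - \<eta> \<longrightarrow>
         (\<exists>S\<in>RSE X. \<exists>x0\<in>unit_sphere X.
            op_norm X S = 1 \<and> norm (S x0) = 1 \<and>
            op_norm X (\<lambda>u. S u - T u) < \<rho> \<and> vnorm X (vdiff X x x0) < \<rho>))"
    by (elim exE conjE) (rule that)
  obtain \<alpha> where \<alpha>: "bounded_map E (inf F (principal A)) 1 \<alpha>"
    and \<alpha>_const: "\<And>f (c :: real). eventually (\<lambda>i. f i = c) (inf F (principal A)) \<Longrightarrow> \<alpha> f = c"
  proof (rule function_algebra.ultralimit_functional[OF function_algebra_le[OF inf_le1] A])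
    fix \<nu> :: "('i \<Rightarrow> real) \<Rightarrow> real"
    assume "bounded_map E (inf F (principal A)) 1 \<nu>"
      "\<And>f c. eventually (\<lambda>i. f i = c) (inf F (principal A)) \<Longrightarrow> \<nu> f = c"
    then show thesis
      by (rule that)
  qed
  obtain \<beta> where \<beta>: "bounded_map E (inf F (principal B)) 1 \<beta>"
    and \<beta>_const: "\<And>f (c :: real). eventually (\<lambda>i. f i = c) (inf F (principal B)) \<Longrightarrow> \<beta> f = c"
  proof (rule function_algebra.ultralimit_functional[OF function_algebra_le[OF inf_le1] B])
    fix \<nu> :: "('i \<Rightarrow> real) \<Rightarrow> real"
    assume "bounded_map E (inf F (principal B)) 1 \<nu>"
      "\<And>f c. eventually (\<lambda>i. f i = c) (inf F (principal B)) \<Longrightarrow> \<nu> f = c"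
    then show thesis
      by (rule that)
  qed
  have ab_le: "\<bar>\<alpha> f\<bar> \<le> 1" "\<bar>\<beta> f\<bar> \<le> 1" if "f \<in> fball E F" for f
  proof -
    have "f \<in> fball E (inf F (principal A))" "f \<in> fball E (inf F (principal B))"
      using that by (auto simp: fball_def eventually_inf_principal elim: eventually_mono)
    then show "\<bar>\<alpha> f\<bar> \<le> 1" "\<bar>\<beta> f\<bar> \<le> 1"
      using \<alpha> \<beta> by (auto simp: bounded_map_def)
  qed
  let ?a = "indicat_real A" and ?b = "indicat_real B"
  have disj: "i \<notin> B" if "i \<in> A" for i
    using AB(1) that by blast
  have "\<bar>?a i\<bar> \<le> 1" "\<bar>?b i\<bar> \<le> 1" "\<bar>?a i + ?b i\<bar> \<le> 1" for i
    using disj by (auto simp: indicator_def)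
  note le = this
  have fballI: "f \<in> fball E F" if "f \<in> E" "\<And>i. \<bar>f i\<bar> \<le> 1" for f
    using that by (simp add: fball_def)
  have ab: "?a \<in> fball E F" "?b \<in> fball E F" "(\<lambda>i. ?a i + ?b i) \<in> fball E F"
    by (rule fballI[OF AB(2) le(1)] fballI[OF AB(3) le(2)] fballI[OF add_closed[OF AB(2,3)] le(3)])+
  have ev: "eventually (\<lambda>i. ?a i = 1) (inf F (principal A))" "eventually (\<lambda>i. ?b i = 0) (inf F (principal A))"
    "eventually (\<lambda>i. ?a i = 0) (inf F (principal B))" "eventually (\<lambda>i. ?b i = 1) (inf F (principal B))"
    using disj by (auto simp: eventually_inf_principal indicator_eq_0_iff indicator_eq_1_iff intro!: always_eventually)
  have vals: "\<alpha> ?a = 1" "\<beta> ?a = 0" "\<alpha> ?b = 0" "\<beta> ?b = 1"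
    by (rule \<alpha>_const[OF ev(1)] \<beta>_const[OF ev(3)] \<alpha>_const[OF ev(2)] \<beta>_const[OF ev(4)])+
  show "\<exists>\<delta>>0. \<delta> < 1 \<and> (\<forall>y1 y2 :: 'y. norm y1 = 1 \<longrightarrow> norm y2 = 1 \<longrightarrow> norm (y1 + y2) / 2 > 1 - \<delta> \<longrightarrow>
        norm (y1 - y2) < \<epsilon>)"
  proof (intro exI[of _ \<eta>] conjI allI impI)
    fix y1 y2 :: 'y
    assume y: "norm y1 = 1" "norm y2 = 1" and mid: "norm (y1 + y2) / 2 > 1 - \<eta>"
    define p where "p = (1/2) *\<^sub>R (y1 + y2)"
    define d where "d = (1/2) *\<^sub>R (y1 - y2)"
    define L where "L f = \<alpha> f *\<^sub>R p + \<beta> f *\<^sub>R d" for f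
    \<comment> \<open>Rewritten in \<open>y1\<close> and \<open>y2\<close>, the coefficients have absolute sum \<open>max \<bar>s\<bar> \<bar>t\<bar>\<close>.\<close>
    have "norm (s *\<^sub>R p + t *\<^sub>R d) \<le> 1" if "\<bar>s\<bar> \<le> 1" "\<bar>t\<bar> \<le> 1" for s t :: real
    proof -
      have "s *\<^sub>R p + t *\<^sub>R d = ((s + t) / 2) *\<^sub>R y1 + ((s - t) / 2) *\<^sub>R y2"
        by (simp add: p_def d_def algebra_simps add_divide_distrib diff_divide_distrib)
      then have "norm (s *\<^sub>R p + t *\<^sub>R d) \<le> \<bar>(s + t) / 2\<bar> + \<bar>(s - t) / 2\<bar>"
        using y by (metis mult.right_neutral norm_scaleR norm_triangle_ineq)
      also have "\<dots> \<le> 1"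
        using that by (auto simp: abs_if field_simps split: if_splits)
      finally show ?thesis .
    qed
    then have L_le: "norm (L f) \<le> 1" if "f \<in> fball E F" for f
      using ab_le[OF that] by (simp add: L_def)
    have "linear_map E L"
      using \<alpha> \<beta> by (simp add: bounded_map_def linear_map_def L_def algebra_simps)
    then have L: "bounded_map E F 1 L"
      using L_le by (simp add: bounded_map_def)
    let ?T = "lift_map L"
    have T_ops: "?T \<in> bounded_ops X"
      by (rule lift_map_bounded_ops[OF L])
    have Tq: "?T (q f) = L f" if "f \<in> fball E F" for f
      using that lift_map_q[OF L] by (simp add: fball_def)
    have Ta: "?T (q ?a) = p" and Tb: "?T (q ?b) = d"
      using ab by (simp_all add: Tq L_def vals)
    have "?T (q (\<lambda>i. ?a i + ?b i)) = p + d"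
      using Tq[OF ab(3)] linear_map_add[of E L, OF _ AB(2,3)] L by (simp add: L_def vals bounded_map_def)
    also have "p + d = y1"
      by (simp add: p_def d_def algebra_simps flip: scaleR_left_distrib)
    finally have "1 \<le> op_norm X ?T"
      using norm_le_op_norm[OF T_ops ab(3)] y by simp
    moreover have "op_norm X ?T \<le> 1"
      using L_le by (intro op_norm_le) (simp add: Tq)
    ultimately have T_norm: "op_norm X ?T = 1"
      by simp
    have a_sphere: "q ?a \<in> unit_sphere X"
    proof -
      have "1 \<le> vnorm X (q ?a)"
      proof (rule ccontr)
        assume less: "\<not> 1 \<le> vnorm X (q ?a)"
        have "eventually (\<lambda>i. i \<in> A \<longrightarrow> False) F"
          using eventually_le_vnorm[OF AB(2)] by eventually_elim (use less in \<open>auto simp: indicator_def\<close>)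
        then show False
          using A by (simp add: trivial_limit_def eventually_inf_principal)
      qed
      moreover have "vnorm X (q ?a) \<le> 1"
        using AB(2) ab(1) by (simp add: vnorm_q_le_iff fball_def)
      ultimately show ?thesis
        using AB(2) by (auto simp: unit_sphere_def carr_eq)
    qed
    have "norm (?T (q ?a)) > 1 - \<eta>"
      using mid by (simp add: Ta p_def)
    from *[rule_format, OF T_ops T_norm a_sphere this]
    obtain S u where S: "S \<in> RSE X" "op_norm X S = 1" and u: "u \<in> unit_sphere X" "norm (S u) = 1"
      and near: "op_norm X (\<lambda>v. S v - ?T v) < \<rho>" "vnorm X (vdiff X (q ?a) u) < \<rho>"
      by blast
    obtain g where g: "g \<in> E" "u = q g"
      using u(1) by (auto simp: unit_sphere_def carr_eq)
    have g1: "eventually (\<lambda>i. \<bar>g i\<bar> \<le> 1) F"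
      using u(1) g vnorm_q_le_iff[OF g(1), of 1] by (simp add: unit_sphere_def)
    have ag: "eventually (\<lambda>i. \<bar>?a i - g i\<bar> \<le> 1/2) F"
    proof -
      have "vnorm X (q (\<lambda>i. ?a i - g i)) \<le> 1/2"
        using near(2) \<rho>(3) by (simp add: g vdiff_q[OF AB(2) g(1)])
      then show ?thesis
        using vnorm_q_le_iff[OF diff_closed[OF AB(2) g(1)]] by blast
    qed
    let ?w = "\<lambda>i. (1/2) * ?b i"
    have "S (q ?w) = 0"
    proof (rule RSE_vanishes[OF S g(1) scale_closed[OF AB(3)]])
      show "eventually (\<lambda>i. \<bar>g i\<bar> + \<bar>(1/2) * ?b i\<bar> \<le> 1) F"
        using g1 ag
      proof eventually_elim
        case (elim i)
        then show ?case
          using disj[of i] by (cases "i \<in> A"; cases "i \<in> B") auto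
      qed
      show "norm (S (q g)) = 1"
        using u(2) g(2) by simp
    qed
    moreover have S_ops: "S \<in> bounded_ops X"
      using S(1) by (simp add: RSE_def)
    then have "linear_map E (\<lambda>f. S (q f))"
      using bounded_map_of_op by (auto simp: bounded_map_def)
    from linear_map_scale[OF this AB(3), of "1/2"] have "S (q ?w) = (1/2) *\<^sub>R S (q ?b)" .
    ultimately have Sb: "S (q ?b) = 0"
      by simp
    have "(\<lambda>v. S v - ?T v) \<in> bounded_ops X"
    proof -
      have lin: "linear_map E (\<lambda>f. S (q f) - L f)"
        using bounded_map_of_op[OF S_ops] L
        by (simp add: bounded_map_def linear_map_def algebra_simps)
      have "norm (S (q f) - L f) \<le> 2" if "f \<in> fball E F" for f
        using norm_triangle_ineq4[of "S (q f)" "L f"] norm_le_op_norm[OF S_ops that] L_le[OF that] S(2)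
        by linarith
      with lin have D: "bounded_map E F 2 (\<lambda>f. S (q f) - L f)"
        by (simp add: bounded_map_def)
      have "lift_map (\<lambda>f. S (q f) - L f) v = S v - ?T v" if "v \<in> carr X" for v
        using that by (auto simp: carr_eq lift_map_q[OF D] lift_map_q[OF L])
      then show ?thesis
        using lift_map_bounded_ops[OF D]
        by (auto simp: bounded_ops_def carr_eq vadd_q vscale_q add_closed scale_closed)
    qed
    from norm_le_op_norm[OF this ab(2)] have "norm d < \<rho>"
      using near(1) by (simp add: Sb Tb)
    then show "norm (y1 - y2) < \<epsilon>"
      using \<rho>(2) by (simp add: d_def)
  qed (use \<eta> \<rho> in auto)
qed

end

section \<open>The concrete spaces\<close>

lemma carr_sup_space:
  "f \<in> carr (sup_space I P) \<longleftrightarrow> P f \<and> (\<exists>C. \<forall>i\<in>I. \<bar>f i\<bar> \<le> C) \<and> (\<forall>i. i \<notin> I \<longrightarrow> f i = 0)"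
  by (auto simp: sup_space_def bounded_iff)

lemma vnorm_sup_space_le_iff:
  assumes "I \<noteq> {}" and f: "f \<in> carr (sup_space I P)"
  shows "vnorm (sup_space I P) f \<le> c \<longleftrightarrow> 0 \<le> c \<and> (\<forall>i\<in>I. \<bar>f i\<bar> \<le> c)"
proof -
  have "bdd_above ((\<lambda>i. \<bar>f i\<bar>) ` I)"
    using f by (auto simp: carr_sup_space intro: bdd_aboveI2)
  then have "(SUP i\<in>I. \<bar>f i\<bar>) \<le> c \<longleftrightarrow> (\<forall>i\<in>I. \<bar>f i\<bar> \<le> c)"
    using assms(1) by (rule cSUP_le_iff[rotated])
  moreover have "0 \<le> c" if "\<forall>i\<in>I. \<bar>f i\<bar> \<le> c"
    using that assms(1) by (meson abs_ge_zero ex_in_conv order_trans)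
  ultimately show ?thesis
    by (auto simp: sup_space_def)
qed

lemma function_model_sup_space:
  fixes P :: "('i \<Rightarrow> real) \<Rightarrow> bool"
  assumes I: "I \<noteq> {}" and zero: "P (\<lambda>i. 0)"
    and add: "\<And>f g. P f \<Longrightarrow> P g \<Longrightarrow> P (\<lambda>i. f i + g i)"
    and mult: "\<And>f g. P f \<Longrightarrow> P g \<Longrightarrow> P (\<lambda>i. f i * g i)"
    and scale: "\<And>f c. P f \<Longrightarrow> P (\<lambda>i. c * f i)"
    and truncation: "\<And>f c. P f \<Longrightarrow> 0 \<le> c \<Longrightarrow> P (\<lambda>i. max (-c) (min c (f i)))"
  shows "function_model (carr (sup_space I P)) (principal I) (sup_space I P) (\<lambda>f. f)"
proof unfold_locales
  fix f g assume f: "f \<in> carr (sup_space I P)" and g: "g \<in> carr (sup_space I P)"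
  obtain C where C: "\<And>i. i \<in> I \<Longrightarrow> \<bar>f i\<bar> \<le> C"
    using f unfolding carr_sup_space by blast
  obtain D where D: "\<And>i. i \<in> I \<Longrightarrow> \<bar>g i\<bar> \<le> D"
    using g unfolding carr_sup_space by blast
  have "\<bar>f i + g i\<bar> \<le> C + D" if "i \<in> I" for i
    using C[OF that] D[OF that] by linarith
  then show "(\<lambda>i. f i + g i) \<in> carr (sup_space I P)"
    using f g add[of f g] unfolding carr_sup_space by auto
  have "\<bar>f i * g i\<bar> \<le> C * D" if "i \<in> I" for i
    unfolding abs_mult using C[OF that] D[OF that] by (intro mult_mono) auto
  then show "(\<lambda>i. f i * g i) \<in> carr (sup_space I P)"
    using f g mult[of f g] unfolding carr_sup_space by auto
next
  fix f :: "'i \<Rightarrow> real" and c assume f: "f \<in> carr (sup_space I P)"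
  obtain C where C: "\<And>i. i \<in> I \<Longrightarrow> \<bar>f i\<bar> \<le> C"
    using f unfolding carr_sup_space by blast
  then have "\<bar>c * f i\<bar> \<le> \<bar>c\<bar> * C" if "i \<in> I" for i
    using that by (simp add: abs_mult mult_left_mono)
  then show "(\<lambda>i. c * f i) \<in> carr (sup_space I P)"
    using f scale[of f c] unfolding carr_sup_space by auto
  show "\<exists>C. eventually (\<lambda>i. \<bar>f i\<bar> \<le> C) (principal I)"
    using C by (auto simp: eventually_principal)
  show "(vnorm (sup_space I P) f \<le> c) = (0 \<le> c \<and> eventually (\<lambda>i. \<bar>f i\<bar> \<le> c) (principal I))"
    using vnorm_sup_space_le_iff[OF I f] by (simp add: eventually_principal)
next
  fix f :: "'i \<Rightarrow> real" and c :: real assume f: "f \<in> carr (sup_space I P)" and c: "0 \<le> c"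
  have "\<bar>max (-c) (min c (f i))\<bar> \<le> c" for i
    using c by linarith
  moreover have "max (-c) (min c (f i)) = 0" if "f i = 0" for i
    using c that by simp
  ultimately show "(\<lambda>i. max (-c) (min c (f i))) \<in> carr (sup_space I P)"
    using f truncation[of f c] c unfolding carr_sup_space by auto
next
  show "(\<lambda>i. 0) \<in> carr (sup_space I P)"
    unfolding carr_sup_space using zero by (auto intro: exI[of _ 0])
qed (auto simp: sup_space_def)

text \<open>
  Two disjoint nonempty sets whose indicators belong to the space are all that the converse needs:
  two points for sequences, a clopen set and its complement for a disconnected compact space.
\<close>

lemma uniformly_convex_iff_BPBp_RSE_sup_space:
  assumes model: "function_model (carr (sup_space I P)) (principal I) (sup_space I P) (\<lambda>f. f)"
    and A: "A \<subseteq> I" "A \<noteq> {}" "P (indicat_real A)" and B: "B \<subseteq> I" "B \<noteq> {}" "P (indicat_real B)"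
    and disj: "A \<inter> B = {}"
  shows "BPBp_RSE (sup_space I P) TYPE('y::banach) \<longleftrightarrow> uniformly_convex TYPE('y)"
proof -
  interpret function_model "carr (sup_space I P)" "principal I" "sup_space I P" "\<lambda>f. f"
    by (rule model)
  have "indicat_real Q \<in> carr (sup_space I P)" if "P (indicat_real Q)" "Q \<subseteq> I" for Q
    using that by (auto simp: carr_sup_space indicator_def intro!: exI[of _ 1])
  moreover have "inf (principal I) (principal Q) \<noteq> bot" if "Q \<subseteq> I" "Q \<noteq> {}" for Q
    using that by (auto simp: principal_eq_bot_iff)
  ultimately show ?thesis
    using BPBp_RSE_of_uniformly_convex uniformly_convex_of_BPBp_RSE[OF _ disj] A B by blast
qed

lemma BPBp_RSE_linf_fin_iff:
  assumes "m \<ge> 2"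
  shows "BPBp_RSE (linf_fin m) TYPE('y::banach) \<longleftrightarrow> uniformly_convex TYPE('y)"
  unfolding linf_fin_def
proof (rule uniformly_convex_iff_BPBp_RSE_sup_space)
  show "function_model (carr (sup_space {..<m} (\<lambda>f. True))) (principal {..<m})
     (sup_space {..<m} (\<lambda>f. True)) (\<lambda>f. f)"
    using assms by (intro function_model_sup_space) (auto simp: lessThan_empty_iff)
  show "{0} \<subseteq> {..<m}" "{1} \<subseteq> {..<m}"
    using assms by auto
qed auto

lemma BPBp_RSE_linf_iff: "BPBp_RSE linf_space TYPE('y::banach) \<longleftrightarrow> uniformly_convex TYPE('y)"
  unfolding linf_space_def
proof (rule uniformly_convex_iff_BPBp_RSE_sup_space)
  show "function_model (carr (sup_space (UNIV :: nat set) (\<lambda>f. True))) (principal UNIV)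
     (sup_space UNIV (\<lambda>f. True)) (\<lambda>f. f)"
    by (rule function_model_sup_space) auto
  show "{0::nat} \<inter> {1} = {}"
    by simp
qed auto

lemma BPBp_RSE_c0_iff: "BPBp_RSE c0_space TYPE('y::banach) \<longleftrightarrow> uniformly_convex TYPE('y)"
  unfolding c0_space_def
proof (rule uniformly_convex_iff_BPBp_RSE_sup_space)
  show "function_model (carr (sup_space UNIV (\<lambda>f :: nat \<Rightarrow> real. f \<longlonglongrightarrow> 0))) (principal UNIV)
     (sup_space UNIV (\<lambda>f. f \<longlonglongrightarrow> 0)) (\<lambda>f. f)"
  proof (rule function_model_sup_space)
    fix f :: "nat \<Rightarrow> real" and c :: real assume f: "f \<longlonglongrightarrow> 0" "0 \<le> c"
    have "(\<lambda>i. max (-c) (min c (f i))) \<longlonglongrightarrow> max (-c) (min c 0)"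
      by (intro tendsto_intros f)
    then show "(\<lambda>i. max (-c) (min c (f i))) \<longlonglongrightarrow> 0"
      using f by simp
  qed (auto intro: tendsto_add_zero tendsto_mult_zero tendsto_mult_right_zero)
  have "indicat_real {k} \<longlonglongrightarrow> 0" for k :: nat
  proof (rule tendsto_eventually)
    show "eventually (\<lambda>n. indicat_real {k} n = 0) sequentially"
      using eventually_gt_at_top[of k] by eventually_elim simp
  qed
  then show "indicat_real {0::nat} \<longlonglongrightarrow> 0" "indicat_real {1::nat} \<longlonglongrightarrow> 0"
    by blast+
qed auto

lemma BPBp_RSE_C_iff:
  fixes K :: "'k topology"
  assumes "\<not> connected_space K"
  shows "BPBp_RSE (C_space K) TYPE('y::banach) \<longleftrightarrow> uniformly_convex TYPE('y)"
proof -
  obtain A where A: "openin K A" "closedin K A" "A \<noteq> {}" "A \<noteq> topspace K"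
    using assms unfolding connected_space_clopen_in by blast
  define B where "B = topspace K - A"
  have B: "openin K B" "closedin K B" "B \<noteq> {}"
    using A openin_subset[OF A(1)] by (auto simp: B_def)
  have clopen: "continuous_map K euclideanreal (indicat_real Q)" if "openin K Q" "closedin K Q" for Q
    unfolding continuous_map_def
  proof (intro conjI allI impI)
    fix U :: "real set"
    have Q: "Q \<subseteq> topspace K"
      by (rule openin_subset[OF that(1)])
    have "openin K (topspace K - Q)"
      using that(2) by blast
    moreover have "{x \<in> topspace K. indicat_real Q x \<in> U} =
        (if 1 \<in> U then Q else {}) \<union> (if 0 \<in> U then topspace K - Q else {})"
      using Q by (auto simp: indicator_def split: if_splits)
    ultimately show "openin K {x \<in> topspace K. indicat_real Q x \<in> U}"
      using that(1) by auto
  qed simp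
  show ?thesis
    unfolding C_space_def
  proof (rule uniformly_convex_iff_BPBp_RSE_sup_space)
    show "function_model (carr (sup_space (topspace K) (continuous_map K euclideanreal)))
       (principal (topspace K)) (sup_space (topspace K) (continuous_map K euclideanreal)) (\<lambda>f. f)"
    proof (rule function_model_sup_space)
      show "topspace K \<noteq> {}"
        using A openin_subset by blast
    qed (auto intro!: continuous_map_add continuous_map_real_mult continuous_map_real_mult_left
        continuous_map_real_max continuous_map_real_min)
    show "A \<subseteq> topspace K" "B \<subseteq> topspace K"
      using A(1) B(1) openin_subset by blast+
    show "continuous_map K euclideanreal (indicat_real A)" "continuous_map K euclideanreal (indicat_real B)"
      using A B by (auto intro: clopen)
  qed (use A B in \<open>auto simp: B_def\<close>)
qed

lemma ess_bdd_iff: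
  "f \<in> ess_bdd \<mu> \<longleftrightarrow> f \<in> borel_measurable \<mu> \<and> (\<exists>C :: real. AE x in \<mu>. \<bar>f x\<bar> \<le> C)"
proof (cases "f \<in> borel_measurable \<mu>")
  case True
  have "(AE x in \<mu>. \<bar>f x\<bar> \<le> max 0 (real_of_ereal e))" if "esssup \<mu> (\<lambda>x. ereal \<bar>f x\<bar>) = e" "e < \<infinity>" for e
    using esssup_AE[where M = \<mu> and f = "\<lambda>x. ereal \<bar>f x\<bar>"] that
    by (cases e) (auto elim!: eventually_mono)
  moreover have "esssup \<mu> (\<lambda>x. ereal \<bar>f x\<bar>) < \<infinity>" if "AE x in \<mu>. \<bar>f x\<bar> \<le> C" for C :: real
  proof -
    have "esssup \<mu> (\<lambda>x. ereal \<bar>f x\<bar>) \<le> ereal C"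
      using True that by (intro esssup_I) auto
    then show ?thesis
      by (rule le_less_trans) simp
  qed
  ultimately show ?thesis
    using True by (auto simp: ess_bdd_def)
qed (simp add: ess_bdd_def)

lemma equiv_ae_eq: "equiv (ess_bdd \<mu>) (ae_eq \<mu>)"
proof (rule equivI)
  show "ae_eq \<mu> \<subseteq> ess_bdd \<mu> \<times> ess_bdd \<mu>"
    by (auto simp: ae_eq_def)
  show "refl_on (ess_bdd \<mu>) (ae_eq \<mu>)"
    by (auto simp: refl_on_def ae_eq_def)
  show "sym (ae_eq \<mu>)"
    by (auto simp: sym_def ae_eq_def eq_commute)
  show "trans (ae_eq \<mu>)"
    unfolding trans_def ae_eq_def by (auto elim: eventually_elim2)
qed

lemma ess_bdd_add: "f \<in> ess_bdd \<mu> \<Longrightarrow> g \<in> ess_bdd \<mu> \<Longrightarrow> (\<lambda>x. f x + g x) \<in> ess_bdd \<mu>"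
  unfolding ess_bdd_iff
proof (elim conjE exE, intro conjI)
  fix C D :: real
  assume "AE x in \<mu>. \<bar>f x\<bar> \<le> C" "AE x in \<mu>. \<bar>g x\<bar> \<le> D"
  then have "AE x in \<mu>. \<bar>f x + g x\<bar> \<le> C + D"
    by eventually_elim linarith
  then show "\<exists>C. AE x in \<mu>. \<bar>f x + g x\<bar> \<le> C" ..
qed simp

lemma ess_bdd_scale: "f \<in> ess_bdd \<mu> \<Longrightarrow> (\<lambda>x. c * f x) \<in> ess_bdd \<mu>"
  unfolding ess_bdd_iff
proof (elim conjE exE, intro conjI)
  fix C :: real
  assume "AE x in \<mu>. \<bar>f x\<bar> \<le> C"
  then have "AE x in \<mu>. \<bar>c * f x\<bar> \<le> \<bar>c\<bar> * C"
    by eventually_elim (simp add: abs_mult mult_left_mono)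
  then show "\<exists>C. AE x in \<mu>. \<bar>c * f x\<bar> \<le> C" ..
qed simp

lemma ess_bdd_mult: "f \<in> ess_bdd \<mu> \<Longrightarrow> g \<in> ess_bdd \<mu> \<Longrightarrow> (\<lambda>x. f x * g x) \<in> ess_bdd \<mu>"
  unfolding ess_bdd_iff
proof (elim conjE exE, intro conjI)
  fix C D :: real
  assume "AE x in \<mu>. \<bar>f x\<bar> \<le> C" "AE x in \<mu>. \<bar>g x\<bar> \<le> D"
  then have "AE x in \<mu>. \<bar>f x * g x\<bar> \<le> C * D"
    by eventually_elim (auto simp: abs_mult intro!: mult_mono)
  then show "\<exists>C. AE x in \<mu>. \<bar>f x * g x\<bar> \<le> C" ..
qed simp

lemma vnorm_Linf_class:
  assumes f: "f \<in> ess_bdd \<mu>"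
  shows "vnorm (Linf_space \<mu>) (ae_eq \<mu> `` {f}) = real_of_ereal (esssup \<mu> (\<lambda>x. ereal \<bar>f x\<bar>))"
proof -
  let ?h = "\<lambda>g. real_of_ereal (esssup \<mu> (\<lambda>x. ereal \<bar>g x\<bar>))"
  have "esssup \<mu> (\<lambda>x. ereal \<bar>g x\<bar>) = esssup \<mu> (\<lambda>x. ereal \<bar>f x\<bar>)" if "g \<in> ae_eq \<mu> `` {f}" for g
    using that by (intro esssup_AE_cong) (auto simp: ae_eq_def ess_bdd_iff elim: eventually_mono)
  then have "?h ` (ae_eq \<mu> `` {f}) = (\<lambda>_. ?h f) ` (ae_eq \<mu> `` {f})"
    by (intro image_cong) simp_all
  also have "\<dots> = {?h f}"
    using f by (intro image_constant[of f]) (simp add: ae_eq_def)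
  finally show ?thesis
    by (simp add: Linf_space_def)
qed

lemma function_model_Linf:
  "function_model (ess_bdd \<mu>) (ae_filter \<mu>) (Linf_space \<mu>) (\<lambda>f. ae_eq \<mu> `` {f})"
proof unfold_locales
  fix f g assume f: "f \<in> ess_bdd \<mu>" and g: "g \<in> ess_bdd \<mu>"
  show "(\<lambda>x. f x + g x) \<in> ess_bdd \<mu>" "(\<lambda>x. f x * g x) \<in> ess_bdd \<mu>"
    by (rule ess_bdd_add[OF f g], rule ess_bdd_mult[OF f g])
  have "(\<lambda>f g. ae_eq \<mu> `` {\<lambda>x. f x + g x}) respects2 ae_eq \<mu>"
  proof (rule congruent2I')
    fix f1 g1 f2 g2 assume *: "(f1, g1) \<in> ae_eq \<mu>" "(f2, g2) \<in> ae_eq \<mu>"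
    then have "AE x in \<mu>. f1 x = g1 x" "AE x in \<mu>. f2 x = g2 x"
      by (auto simp: ae_eq_def)
    then have "AE x in \<mu>. f1 x + f2 x = g1 x + g2 x"
      by eventually_elim simp
    then have "(\<lambda>x. f1 x + f2 x, \<lambda>x. g1 x + g2 x) \<in> ae_eq \<mu>"
      using * ess_bdd_add unfolding ae_eq_def by blast
    then show "ae_eq \<mu> `` {\<lambda>x. f1 x + f2 x} = ae_eq \<mu> `` {\<lambda>x. g1 x + g2 x}"
      by (rule equiv_class_eq[OF equiv_ae_eq])
  qed
  from UN_equiv_class2[OF equiv_ae_eq equiv_ae_eq this f g]
  show "vadd (Linf_space \<mu>) (ae_eq \<mu> `` {f}) (ae_eq \<mu> `` {g}) = ae_eq \<mu> `` {\<lambda>x. f x + g x}"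
    by (simp add: Linf_space_def)
next
  fix f c assume f: "f \<in> ess_bdd \<mu>"
  show "(\<lambda>x. c * f x) \<in> ess_bdd \<mu>"
    using f by (rule ess_bdd_scale)
  show "\<exists>C. eventually (\<lambda>x. \<bar>f x\<bar> \<le> C) (ae_filter \<mu>)"
    using f by (simp add: ess_bdd_iff)
  have "(\<lambda>f. ae_eq \<mu> `` {\<lambda>x. c * f x}) respects ae_eq \<mu>"
  proof (rule congruentI)
    fix f g assume *: "(f, g) \<in> ae_eq \<mu>"
    then have "AE x in \<mu>. f x = g x"
      by (auto simp: ae_eq_def)
    then have "AE x in \<mu>. c * f x = c * g x"
      by eventually_elim simp
    then have "(\<lambda>x. c * f x, \<lambda>x. c * g x) \<in> ae_eq \<mu>"
      using * ess_bdd_scale unfolding ae_eq_def by blast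
    then show "ae_eq \<mu> `` {\<lambda>x. c * f x} = ae_eq \<mu> `` {\<lambda>x. c * g x}"
      by (rule equiv_class_eq[OF equiv_ae_eq])
  qed
  from UN_equiv_class[OF equiv_ae_eq this f]
  show "vscale (Linf_space \<mu>) c (ae_eq \<mu> `` {f}) = ae_eq \<mu> `` {\<lambda>x. c * f x}"
    by (simp add: Linf_space_def)
  define s where "s = esssup \<mu> (\<lambda>x. ereal \<bar>f x\<bar>)"
  have fm: "f \<in> borel_measurable \<mu>" and s: "s < \<infinity>"
    using f by (auto simp: ess_bdd_def s_def)
  have AE_s: "AE x in \<mu>. ereal \<bar>f x\<bar> \<le> s"
    unfolding s_def by (rule esssup_AE)
  have s_le: "s \<le> ereal c" if "AE x in \<mu>. \<bar>f x\<bar> \<le> c" for c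
    unfolding s_def using fm that by (intro esssup_I) auto
  show "(vnorm (Linf_space \<mu>) (ae_eq \<mu> `` {f}) \<le> c) = (0 \<le> c \<and> (AE x in \<mu>. \<bar>f x\<bar> \<le> c))"
    unfolding vnorm_Linf_class[OF f] s_def[symmetric]
  proof (cases s)
    case (real r)
    have "0 \<le> r"
    proof (rule ccontr)
      assume "\<not> 0 \<le> r"
      then have "AE x in \<mu>. \<bar>f x\<bar> \<le> r - 1"
        using AE_s by (auto simp: real elim!: eventually_mono)
      from s_le[OF this] show False
        by (simp add: real)
    qed
    then show "(real_of_ereal s \<le> c) = (0 \<le> c \<and> (AE x in \<mu>. \<bar>f x\<bar> \<le> c))"
      using AE_s s_le[of c] by (auto simp: real elim!: eventually_mono)
  next
    \<comment> \<open>The essential supremum is minus infinity only for the zero measure; its real part is then 0.\<close>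
    case MInf
    then show "(real_of_ereal s \<le> c) = (0 \<le> c \<and> (AE x in \<mu>. \<bar>f x\<bar> \<le> c))"
      using AE_s by (auto elim!: eventually_mono)
  qed (use s in simp)
next
  fix f :: "'a \<Rightarrow> real" and c :: real assume f: "f \<in> ess_bdd \<mu>" and c: "0 \<le> c"
  have "\<bar>max (-c) (min c (f x))\<bar> \<le> c" for x
    using c by linarith
  then show "(\<lambda>x. max (-c) (min c (f x))) \<in> ess_bdd \<mu>"
    using f by (auto simp: ess_bdd_iff intro!: exI[of _ c])
qed (auto simp: Linf_space_def quotient_def ess_bdd_iff)

text \<open>
  If every measurable set is null or conull, the limit \<open>c\<close> of \<open>f\<close> along an ultrafilter is the almost
  everywhere value: the measurable set where \<open>f\<close> is within \<open>1 / (n + 1)\<close> of \<open>c\<close> belongs to the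
  ultrafilter, so it is not null.
\<close>

lemma AE_constant_of_trivial_sets:
  assumes trivial: "\<And>A. A \<in> sets \<mu> \<Longrightarrow> (AE x in \<mu>. x \<notin> A) \<or> (AE x in \<mu>. x \<in> A)"
    and f: "f \<in> ess_bdd \<mu>"
  shows "\<exists>c. AE x in \<mu>. f x = c"
proof (cases "ae_filter \<mu> = bot")
  case True
  then show ?thesis
    by (auto simp: trivial_limit_def elim: eventually_mono)
next
  case False
  from ultrafilter_exists[OF this] obtain U where U: "U \<le> ae_filter \<mu>" "U \<noteq> bot"
    "\<And>P. eventually P U \<or> eventually (\<lambda>i. \<not> P i) U"
    by blast
  have fm: "f \<in> borel_measurable \<mu>"
    using f by (simp add: ess_bdd_iff)
  obtain C where "AE x in \<mu>. \<bar>f x\<bar> \<le> C"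
    using f by (auto simp: ess_bdd_iff)
  then have lim: "(f \<longlongrightarrow> Lim U f) U"
    using U by (intro ultrafilter_bounded_convergent) (auto intro: filter_leD)
  have close: "AE x in \<mu>. \<bar>f x - Lim U f\<bar> < 1 / real (Suc n)" for n
  proof -
    let ?A = "{x \<in> space \<mu>. \<bar>f x - Lim U f\<bar> < 1 / real (Suc n)}"
    have "\<not> (AE x in \<mu>. x \<notin> ?A)"
    proof
      assume "AE x in \<mu>. x \<notin> ?A"
      then have "AE x in \<mu>. \<not> \<bar>f x - Lim U f\<bar> < 1 / real (Suc n)"
        using AE_space by eventually_elim simp
      then have "eventually (\<lambda>x. \<not> \<bar>f x - Lim U f\<bar> < 1 / real (Suc n)) U"
        using U(1) by (rule filter_leD[rotated])
      moreover have "eventually (\<lambda>x. \<bar>f x - Lim U f\<bar> < 1 / real (Suc n)) U"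
        using tendstoD[OF lim, of "1 / real (Suc n)"] by (simp add: dist_real_def)
      ultimately have "eventually (\<lambda>x. False) U"
        by eventually_elim simp
      then show False
        using U(2) by (simp add: trivial_limit_def)
    qed
    moreover have "?A \<in> sets \<mu>"
      using fm by measurable
    ultimately have "AE x in \<mu>. x \<in> ?A"
      using trivial by blast
    then show ?thesis
      by (auto elim: eventually_mono)
  qed
  then have "AE x in \<mu>. \<forall>n. \<bar>f x - Lim U f\<bar> < 1 / real (Suc n)"
    by (subst AE_all_countable) blast
  then have "AE x in \<mu>. f x = Lim U f"
  proof eventually_elim
    case (elim x)
    have "\<bar>f x - Lim U f\<bar> \<le> 0"
    proof (rule ccontr)
      assume "\<not> \<bar>f x - Lim U f\<bar> \<le> 0"
      then obtain n where "1 / real (Suc n) < \<bar>f x - Lim U f\<bar>"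
        using nat_approx_posE[of "\<bar>f x - Lim U f\<bar>"] by auto
      then show False
        using elim[rule_format, of n] by simp
    qed
    then show ?case
      by simp
  qed
  then show ?thesis ..
qed

text \<open>
  Otherwise all classes are constants, and two constants are linearly dependent.
\<close>

lemma nontrivial_set_of_dim_ge_2:
  assumes "dim_ge_2 (Linf_space \<mu>)"
  obtains A where "A \<in> sets \<mu>" "\<not> (AE x in \<mu>. x \<notin> A)" "\<not> (AE x in \<mu>. x \<in> A)"
proof (rule ccontr)
  assume "\<not> thesis"
  with that have trivial: "\<And>A. A \<in> sets \<mu> \<Longrightarrow> (AE x in \<mu>. x \<notin> A) \<or> (AE x in \<mu>. x \<in> A)"
    by blast
  interpret function_model "ess_bdd \<mu>" "ae_filter \<mu>" "Linf_space \<mu>" "\<lambda>f. ae_eq \<mu> `` {f}"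
    by (rule function_model_Linf)
  obtain f g where f: "f \<in> ess_bdd \<mu>" and g: "g \<in> ess_bdd \<mu>" and
    *: "\<And>a b. vadd (Linf_space \<mu>) (vscale (Linf_space \<mu>) a (ae_eq \<mu> `` {f}))
       (vscale (Linf_space \<mu>) b (ae_eq \<mu> `` {g})) = vzero (Linf_space \<mu>) \<Longrightarrow> a = 0 \<and> b = 0"
    using assms unfolding dim_ge_2_def carr_eq by blast
  have independent: "a = 0 \<and> b = 0" if ab: "AE x in \<mu>. a * f x + b * g x = 0" for a b
  proof (rule *)
    have "(\<lambda>x. a * f x + b * g x, \<lambda>x. 0) \<in> ae_eq \<mu>"
      using ab f g by (simp add: ae_eq_def add_closed scale_closed zero_closed)
    then show "vadd (Linf_space \<mu>) (vscale (Linf_space \<mu>) a (ae_eq \<mu> `` {f}))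
       (vscale (Linf_space \<mu>) b (ae_eq \<mu> `` {g})) = vzero (Linf_space \<mu>)"
      using equiv_class_eq[OF equiv_ae_eq]
      by (simp add: vscale_q vadd_q f g scale_closed) (simp add: Linf_space_def)
  qed
  obtain c d where c: "AE x in \<mu>. f x = c" and d: "AE x in \<mu>. g x = d"
    using AE_constant_of_trivial_sets[OF trivial] f g by metis
  have "AE x in \<mu>. d * f x + (- c) * g x = 0"
    using c d by eventually_elim simp
  from independent[OF this] have "c = 0"
    by simp
  have "AE x in \<mu>. 1 * f x + 0 * g x = 0"
    using c by eventually_elim (simp add: \<open>c = 0\<close>)
  from independent[OF this] show False
    by simp
qed

lemma BPBp_RSE_Linf_iff:
  assumes "dim_ge_2 (Linf_space \<mu>)"
  shows "BPBp_RSE (Linf_space \<mu>) TYPE('y::banach) \<longleftrightarrow> uniformly_convex TYPE('y)"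
proof -
  interpret function_model "ess_bdd \<mu>" "ae_filter \<mu>" "Linf_space \<mu>" "\<lambda>f. ae_eq \<mu> `` {f}"
    by (rule function_model_Linf)
  obtain A where A: "A \<in> sets \<mu>" "\<not> (AE x in \<mu>. x \<notin> A)" "\<not> (AE x in \<mu>. x \<in> A)"
    using nontrivial_set_of_dim_ge_2[OF assms] by blast
  have bdd: "indicat_real Q \<in> ess_bdd \<mu>" if "Q \<in> sets \<mu>" for Q
    using that by (auto simp: ess_bdd_iff indicator_def intro!: exI[of _ 1])
  have "inf (ae_filter \<mu>) (principal A) \<noteq> bot"
    using A(2) by (simp add: trivial_limit_def eventually_inf_principal)
  moreover have "inf (ae_filter \<mu>) (principal (space \<mu> - A)) \<noteq> bot"
  proof
    assume "inf (ae_filter \<mu>) (principal (space \<mu> - A)) = bot"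
    then have "AE x in \<mu>. x \<in> space \<mu> - A \<longrightarrow> False"
      by (simp add: trivial_limit_def eventually_inf_principal)
    then have "AE x in \<mu>. x \<in> A"
      using AE_space by eventually_elim blast
    then show False
      using A(3) by blast
  qed
  moreover have "A \<inter> (space \<mu> - A) = {}"
    by blast
  ultimately show ?thesis
    using BPBp_RSE_of_uniformly_convex uniformly_convex_of_BPBp_RSE bdd A(1) sets.compl_sets by blast
qed

theorem theorem3p15:
  fixes \<mu> :: "'a measure" and K :: "'k topology"
  assumes dim_Y: "\<exists>B :: 'y::banach set. independent B \<and> card B = 2"
    and dim_Linf: "dim_ge_2 (Linf_space \<mu>)"
    and K: "compact_space K" "Hausdorff_space K" "\<not> connected_space K"
  shows "((\<exists>m\<ge>2. BPBp_RSE (linf_fin m) TYPE('y)) \<longleftrightarrow> uniformly_convex TYPE('y)) \<and>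
         (BPBp_RSE c0_space TYPE('y) \<longleftrightarrow> uniformly_convex TYPE('y)) \<and>
         (BPBp_RSE linf_space TYPE('y) \<longleftrightarrow> uniformly_convex TYPE('y)) \<and>
         (BPBp_RSE (Linf_space \<mu>) TYPE('y) \<longleftrightarrow> uniformly_convex TYPE('y)) \<and>
         (BPBp_RSE (C_space K) TYPE('y) \<longleftrightarrow> uniformly_convex TYPE('y))"
  using BPBp_RSE_linf_fin_iff BPBp_RSE_c0_iff BPBp_RSE_linf_iff
    BPBp_RSE_Linf_iff[OF dim_Linf] BPBp_RSE_C_iff[OF K(3)] by blast

end
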